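(* Let $\Delta \ge 2$ be an integer, let $H$ be a connected, $\Delta$-regular graph, and let $X = X_{n,p}^H$ denote the number of copies of $H$ in $G_{n,p}$. Then, for every fixed positive constant $\delta$ and all $p = p(n)$ satisfying $n^{-1} \ll p^{\Delta/2} \ll n^{-1}(\log n)^{\frac{1}{v_H-2}}$, $$\lim_{n\to\infty} \frac{-\log \mathbb{P}\big(X \ge (1+\delta)\mathbb{E}[X]\big)}{\mathbb{E}[X]} = (1+\delta)\log(1+\delta)-\delta.$$
   Context: $G_{n,p}$ is the binomial random graph on the vertex set $\{1,\dots,n\}$, in which each pair is an edge independently with probability $p$. A copy of $H$ in a graph $G$ is a (not necessarily induced) subgraph of $G$ isomorphic to $H$. $v_H$ is the number of vertices of $H$. For functions of $n$, $f\ll g$ means $f(n)/g(n)\to 0$ as $n\to\infty$. Logarithms are natural. *)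

theory Defs
  imports "HOL-Probability.Probability"
begin

text \<open>A graph is a pair of a vertex set and a set of edges, the edges of a simple graph being
  two-element sets of vertices.\<close>

type_synonym 'a graph = "'a set \<times> 'a set set"

abbreviation verts :: "'a graph \<Rightarrow> 'a set" where
  "verts G \<equiv> fst G"

abbreviation edges :: "'a graph \<Rightarrow> 'a set set" where
  "edges G \<equiv> snd G"

definition all_pairs :: "'a set \<Rightarrow> 'a set set" where
  "all_pairs V = {e. e \<subseteq> V \<and> card e = 2}"

definition simple_graph :: "'a graph \<Rightarrow> bool" where
  "simple_graph G \<longleftrightarrow> edges G \<subseteq> all_pairs (verts G)"

definition regular_graph :: "nat \<Rightarrow> 'a graph \<Rightarrow> bool" where
  "regular_graph d G \<longleftrightarrow> (\<forall>v\<in>verts G. card {e \<in> edges G. v \<in> e} = d)"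

text \<open>The graph without vertices is not connected.\<close>

definition connected_graph :: "'a graph \<Rightarrow> bool" where
  "connected_graph G \<longleftrightarrow> verts G \<noteq> {} \<and>
     (\<forall>u\<in>verts G. \<forall>v\<in>verts G. (u, v) \<in> {(x, y). {x, y} \<in> edges G}\<^sup>*)"

definition subgraph :: "'a graph \<Rightarrow> 'a graph \<Rightarrow> bool" where
  "subgraph K G \<longleftrightarrow> simple_graph K \<and> verts K \<subseteq> verts G \<and> edges K \<subseteq> edges G"

definition isomorphic_graphs :: "'a graph \<Rightarrow> 'b graph \<Rightarrow> bool" where
  "isomorphic_graphs G K \<longleftrightarrow> (\<exists>f. bij_betw f (verts G) (verts K) \<and>
     (\<forall>u\<in>verts G. \<forall>v\<in>verts G. {u, v} \<in> edges G \<longleftrightarrow> {f u, f v} \<in> edges K))"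

definition copies :: "'a graph \<Rightarrow> 'b graph \<Rightarrow> 'b graph set" where
  "copies H G = {K. subgraph K G \<and> isomorphic_graphs H K}"

text \<open>The function \<open>\<omega>\<close> tells, independently for each pair, whether that pair is an edge;
  the argument \<open>False\<close> is its value outside the set of pairs.\<close>

definition gnp :: "nat \<Rightarrow> real \<Rightarrow> nat graph pmf" where
  "gnp n p = map_pmf (\<lambda>\<omega>. ({1..n}, {e \<in> all_pairs {1..n}. \<omega> e}))
     (Pi_pmf (all_pairs {1..n}) False (\<lambda>_. bernoulli_pmf p))"

definition copy_count :: "'a graph \<Rightarrow> 'b graph \<Rightarrow> real" where
  "copy_count H G = real (card (copies H G))"

end

theory Submission
  imports Defs "HOL-Real_Asymp.Real_Asymp"
begin

text \<open>
  Call a copy of \<open>H\<close> in \<open>G\<close> isolated if it shares no vertex with another copy. Let \<open>m = n p\<^sup>\<Delta>\<^sup>/\<^sup>2\<close>,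
  so that \<open>\<mu> = E[X]\<close> has order \<open>m\<^sup>v\<close>.

  Upper bound. The exponential moments of the number of isolated copies are at most those of a
  Poisson variable of mean \<open>\<mu>\<close>. If many copies are not isolated, choose about \<open>\<epsilon>\<mu>\<close> of them, add an
  overlapping partner for each, and let \<open>F\<close> be the union. By Finner's inequality \<open>F\<close> has at least
  order \<open>m\<^sup>2\<close> edges. Every copy in \<open>F\<close> contains a vertex of degree above \<open>\<Delta>\<close>, which makes
  \<open>2|F| - \<Delta>|V(F)|\<close> proportional to \<open>|F|\<close>, so that a union bound over \<open>F\<close> gives \<open>exp (-c m\<^sup>2 ln n)\<close>.
  As \<open>m\<^sup>v\<^sup>-\<^sup>2\<close> is small compared to \<open>ln n\<close>, this is negligible.

  Lower bound. Sum, over all families \<open>S\<close> of \<open>k\<close> disjoint copies, \<open>k\<close> being \<open>(1 + \<delta>)\<mu>\<close> rounded up, the probability that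
  the copies in the random graph are exactly those in \<open>S\<close>. Harris' inequality bounds the
  probability of creating no further copy, given \<open>S\<close>, by about \<open>exp (-\<mu>)\<close>.
\<close>

section \<open>Finner's inequality\<close>

text \<open>The obstacle is clustering. A clique on order m vertices contains order m^v copies of
  \<open>H\<close>, that is order \<mu>, and costs only exp (-c m^2 ln n). So exponential moments of
  X itself are of no use, and the upper bound on p marks the point where such cliques stop competing
  with exp (-c \<mu>). Finner's inequality says that, up to constants, no graph makes the copies
  with fewer edges than a clique. Many edges alone do not make a union bound work: about n^u p^e =
  n^(u - 2e/\<Delta>) m^(2e/\<Delta>) bounds the contribution of graphs with u vertices and e edges,
  and for disjoint copies the power of n disappears. Overlaps have to make that exponent negative,
  in proportion to e, so that n^(-c e) beats all polylogarithmic factors. The lower bound rests on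
  the same rigidity. A union of disjoint copies is \<Delta>-regular and hides no further copy, and a
  nonempty proper set of edges of \<open>H\<close> has 2e < \<Delta>u, so copies sharing edges with
  the family are negligible in number.\<close>

lemma root_prod:
  assumes "finite S" "d > 0"
  shows "root d (\<Prod>i\<in>S. x i) = (\<Prod>i\<in>S. root d (x i))"
  using assms(1) by induction (use assms(2) in \<open>auto simp: real_root_mult\<close>)

text \<open>Hoelder's inequality for \<open>d\<close> functions with equal exponents. Normalise each
  \<open>f j\<close> to have sum 1 and apply the AM-GM inequality pointwise; if some sum vanishes,
  the left side is 0.\<close>

lemma holder_root:
  fixes f :: "'j \<Rightarrow> 'a \<Rightarrow> real"
  assumes "finite J" "card J = d" "d > 0" "finite A"
    and nonneg: "\<And>j a. j \<in> J \<Longrightarrow> a \<in> A \<Longrightarrow> f j a \<ge> 0"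
  shows "(\<Sum>a\<in>A. \<Prod>j\<in>J. root d (f j a)) \<le> (\<Prod>j\<in>J. root d (\<Sum>a\<in>A. f j a))"
proof (cases "\<exists>j\<in>J. (\<Sum>a\<in>A. f j a) = 0")
  case True
  then obtain j where j: "j \<in> J" "(\<Sum>a\<in>A. f j a) = 0" by blast
  then have "f j a = 0" if "a \<in> A" for a
    using nonneg that assms(4) by (subst (asm) sum_nonneg_eq_0_iff) auto
  then have "(\<Prod>j\<in>J. root d (f j a)) = 0" if "a \<in> A" for a
    using that j assms(1) by (intro prod_zero) (auto intro!: bexI[of _ j])
  then have "(\<Sum>a\<in>A. \<Prod>j\<in>J. root d (f j a)) = 0" by simp
  also have "\<dots> \<le> (\<Prod>j\<in>J. root d (\<Sum>a\<in>A. f j a))"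
    using nonneg by (intro prod_nonneg) (auto intro!: sum_nonneg simp: \<open>d > 0\<close>)
  finally show ?thesis .
next
  case False
  define S where "S j = (\<Sum>a\<in>A. f j a)" for j
  have S: "S j > 0" if "j \<in> J" for j
    using False that nonneg unfolding S_def by (metis order_le_less sum_nonneg)
  have ne: "J \<noteq> {}" using assms by auto
  have amgm: "(\<Prod>j\<in>J. root d (f j a / S j)) \<le> (\<Sum>j\<in>J. f j a / S j / d)" if "a \<in> A" for a
  proof -
    have x: "f j a / S j \<ge> 0" if "j \<in> J" for j
      using nonneg[OF that \<open>a \<in> A\<close>] S[OF that] by simp
    have "(\<Prod>j\<in>J. root d (f j a / S j)) = root d (\<Prod>j\<in>J. f j a / S j)"
      using root_prod[OF \<open>finite J\<close> \<open>d > 0\<close>] by metis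
    also have "\<dots> = (\<Prod>j\<in>J. f j a / S j) powr (1 / d)"
    proof (cases "(\<Prod>j\<in>J. f j a / S j) = 0")
      case True
      then show ?thesis by simp
    next
      case False
      then have "(\<Prod>j\<in>J. f j a / S j) > 0"
        using prod_nonneg[of J "\<lambda>j. f j a / S j"] x by force
      then show ?thesis using \<open>d > 0\<close> by (intro root_powr_inverse less_imp_le)
    qed
    also have "\<dots> \<le> (\<Sum>j\<in>J. f j a / S j / d)"
      using arith_geom_mean[OF \<open>finite J\<close> ne x] \<open>card J = d\<close> by simp
    finally show ?thesis .
  qed
  have "(\<Sum>a\<in>A. \<Prod>j\<in>J. root d (f j a)) =
      (\<Prod>j\<in>J. root d (S j)) * (\<Sum>a\<in>A. \<Prod>j\<in>J. root d (f j a / S j))"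
  proof -
    have "(\<Prod>j\<in>J. root d (f j a)) = (\<Prod>j\<in>J. root d (S j)) * (\<Prod>j\<in>J. root d (f j a / S j))" for a
      unfolding prod.distrib[symmetric] real_root_mult[symmetric]
      using S by (intro prod.cong) (auto simp: less_imp_neq[THEN not_sym])
    then show ?thesis by (simp add: sum_distrib_left)
  qed
  also have "\<dots> \<le> (\<Prod>j\<in>J. root d (S j)) * 1"
  proof (intro mult_left_mono prod_nonneg)
    have "(\<Sum>a\<in>A. \<Prod>j\<in>J. root d (f j a / S j)) \<le> (\<Sum>a\<in>A. \<Sum>j\<in>J. f j a / S j / d)"
      by (intro sum_mono amgm)
    also have "\<dots> = (\<Sum>j\<in>J. (\<Sum>a\<in>A. f j a) / S j / d)"
      by (subst sum.swap) (simp add: sum_divide_distrib)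
    also have "\<dots> = (\<Sum>j\<in>J. 1 / d)"
      using S unfolding S_def by (intro sum.cong refl) (metis divide_self less_irrefl)
    also have "\<dots> = 1" using assms by simp
    finally show "(\<Sum>a\<in>A. \<Prod>j\<in>J. root d (f j a / S j)) \<le> 1" .
  qed (use S in \<open>auto simp: less_imp_le \<open>d > 0\<close>\<close>)
  finally show ?thesis by (simp add: S_def)
qed

lemma sum_PiE_insert:
  fixes g :: "('i \<Rightarrow> 'v) \<Rightarrow> real"
  assumes "t \<notin> I"
  shows "(\<Sum>x\<in>insert t I \<rightarrow>\<^sub>E A. g x) = (\<Sum>x\<in>I \<rightarrow>\<^sub>E A. \<Sum>a\<in>A. g (x(t := a)))"
proof -
  have "(\<Sum>x\<in>insert t I \<rightarrow>\<^sub>E A. g x) = (\<Sum>(a, x)\<in>A \<times> (I \<rightarrow>\<^sub>E A). g (x(t := a)))"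
    unfolding PiE_insert_eq
    by (subst sum.reindex[OF inj_combinator[OF assms]]) (auto simp: case_prod_unfold)
  also have "\<dots> = (\<Sum>a\<in>A. \<Sum>x\<in>I \<rightarrow>\<^sub>E A. g (x(t := a)))"
    by (simp add: sum.cartesian_product)
  finally show ?thesis by (subst (asm) sum.swap)
qed

text \<open>Coordinates are summed out one at a time. Only the \<open>d\<close> factors whose set
  contains \<open>t\<close> depend on that coordinate, so Hoelder with \<open>d\<close> functions
  applies to them, and the remaining coordinates are still covered exactly \<open>d\<close>
  times.\<close>

theorem finner_inequality:
  fixes h :: "'j \<Rightarrow> ('i \<Rightarrow> 'v) \<Rightarrow> real"
  assumes "finite I" "finite J" "finite A" "d > 0"
    and "\<And>j. j \<in> J \<Longrightarrow> e j \<subseteq> I"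
    and "\<And>i. i \<in> I \<Longrightarrow> card {j\<in>J. i \<in> e j} = d"
    and "\<And>j x. j \<in> J \<Longrightarrow> h j x \<ge> 0"
  shows "(\<Sum>x\<in>I \<rightarrow>\<^sub>E A. \<Prod>j\<in>J. root d (h j (restrict x (e j))))
    \<le> (\<Prod>j\<in>J. root d (\<Sum>y\<in>e j \<rightarrow>\<^sub>E A. h j y))"
  using assms(1,5-)
proof (induction I arbitrary: e h)
  case empty
  then have "e j = {}" if "j \<in> J" for j using that by auto
  then have "(\<Prod>j\<in>J. root d (\<Sum>y\<in>e j \<rightarrow>\<^sub>E A. h j y)) = (\<Prod>j\<in>J. root d (h j (\<lambda>_. undefined)))"
    by (intro prod.cong) auto
  moreover have "(\<Prod>j\<in>J. root d (h j (restrict x (e j)))) = (\<Prod>j\<in>J. root d (h j (\<lambda>_. undefined)))" for x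
    using \<open>\<And>j. j \<in> J \<Longrightarrow> e j = {}\<close> by (intro prod.cong) (auto simp: restrict_def)
  ultimately show ?case by simp
next
  case (insert t I)
  define e' where "e' j = e j - {t}" for j
  \<comment> \<open>The marginal of \<open>h j\<close> over the coordinate \<open>t\<close>. The
    induction hypothesis is applied to these functions, which is why \<open>e\<close> and
    \<open>h\<close> are generalised.\<close>
  define h' where "h' j y = (if t \<in> e j then \<Sum>a\<in>A. h j (y(t := a)) else h j y)" for j y
  define T where "T = {j\<in>J. t \<in> e j}"
  have T: "T \<subseteq> J" "finite T" "card T = d"
    using \<open>finite J\<close> insert.prems(2)[of t] by (auto simp: T_def)
  have step: "(\<Sum>a\<in>A. \<Prod>j\<in>J. root d (h j (restrict (x(t := a)) (e j))))
      \<le> (\<Prod>j\<in>J. root d (h' j (restrict x (e' j))))" for x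
  proof -
    let ?R = "\<Prod>j\<in>J - T. root d (h' j (restrict x (e' j)))"
    have split: "(\<Prod>j\<in>J. g j) = (\<Prod>j\<in>T. g j) * (\<Prod>j\<in>J - T. g j)" for g :: "'j \<Rightarrow> real"
      using T \<open>finite J\<close> by (metis mult.commute prod.subset_diff)
    have "(\<Prod>j\<in>J. root d (h j (restrict (x(t := a)) (e j)))) =
        (\<Prod>j\<in>T. root d (h j ((restrict x (e' j))(t := a)))) * ?R" for a
    proof -
      have "restrict (x(t := a)) (e j) = (restrict x (e' j))(t := a)" if "j \<in> T" for j
        using that by (auto simp: T_def e'_def restrict_def fun_eq_iff)
      moreover have "h j (restrict (x(t := a)) (e j)) = h' j (restrict x (e' j))" if "j \<in> J - T" for j
      proof -
        have "restrict (x(t := a)) (e j) = restrict x (e' j)"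
          using that by (auto simp: T_def e'_def restrict_def fun_eq_iff)
        then show ?thesis using that by (simp add: T_def h'_def)
      qed
      ultimately show ?thesis unfolding split by simp
    qed
    then have "(\<Sum>a\<in>A. \<Prod>j\<in>J. root d (h j (restrict (x(t := a)) (e j)))) =
        (\<Sum>a\<in>A. \<Prod>j\<in>T. root d (h j ((restrict x (e' j))(t := a)))) * ?R"
      by (simp add: sum_distrib_right)
    also have "\<dots> \<le> (\<Prod>j\<in>T. root d (\<Sum>a\<in>A. h j ((restrict x (e' j))(t := a)))) * ?R"
      using T insert.prems(3) \<open>d > 0\<close> \<open>finite A\<close>
      by (intro mult_right_mono holder_root prod_nonneg) (auto simp: h'_def intro!: sum_nonneg)
    also have "(\<Prod>j\<in>T. root d (\<Sum>a\<in>A. h j ((restrict x (e' j))(t := a)))) =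
        (\<Prod>j\<in>T. root d (h' j (restrict x (e' j))))"
      by (intro prod.cong) (auto simp: T_def h'_def)
    finally show ?thesis unfolding split .
  qed
  have "(\<Sum>x\<in>insert t I \<rightarrow>\<^sub>E A. \<Prod>j\<in>J. root d (h j (restrict x (e j)))) =
      (\<Sum>x\<in>I \<rightarrow>\<^sub>E A. \<Sum>a\<in>A. \<Prod>j\<in>J. root d (h j (restrict (x(t := a)) (e j))))"
    by (rule sum_PiE_insert[OF insert.hyps(2)])
  also have "\<dots> \<le> (\<Sum>x\<in>I \<rightarrow>\<^sub>E A. \<Prod>j\<in>J. root d (h' j (restrict x (e' j))))"
    by (intro sum_mono step)
  also have "\<dots> \<le> (\<Prod>j\<in>J. root d (\<Sum>y\<in>e' j \<rightarrow>\<^sub>E A. h' j y))"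
  proof (rule insert.IH)
    show "e' j \<subseteq> I" if "j \<in> J" for j using insert.prems(1)[OF that] by (auto simp: e'_def)
    show "card {j \<in> J. i \<in> e' j} = d" if "i \<in> I" for i
    proof -
      have "{j \<in> J. i \<in> e' j} = {j \<in> J. i \<in> e j}" using that insert.hyps by (auto simp: e'_def)
      then show ?thesis using insert.prems(2)[of i] that by simp
    qed
    show "h' j x \<ge> 0" if "j \<in> J" for j x
      using insert.prems(3)[OF that] by (auto simp: h'_def intro!: sum_nonneg)
  qed
  also have "(\<Prod>j\<in>J. root d (\<Sum>y\<in>e' j \<rightarrow>\<^sub>E A. h' j y)) = (\<Prod>j\<in>J. root d (\<Sum>y\<in>e j \<rightarrow>\<^sub>E A. h j y))"
  proof (intro prod.cong refl arg_cong[where f = "root d"])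
    fix j
    show "(\<Sum>y\<in>e' j \<rightarrow>\<^sub>E A. h' j y) = (\<Sum>y\<in>e j \<rightarrow>\<^sub>E A. h j y)"
    proof (cases "t \<in> e j")
      case True
      then have "e j = insert t (e' j)" "t \<notin> e' j" by (auto simp: e'_def)
      then show ?thesis using sum_PiE_insert[of t "e' j" "h j" A] True by (simp add: h'_def)
    qed (simp add: e'_def h'_def)
  qed
  finally show ?case .
qed

section \<open>Independent random edges\<close>

abbreviation bernoulli_field :: "'a set \<Rightarrow> real \<Rightarrow> ('a \<Rightarrow> bool) pmf" where
  "bernoulli_field A p \<equiv> Pi_pmf A False (\<lambda>_. bernoulli_pmf p)"

lemma finite_set_bernoulli_field: "finite A \<Longrightarrow> finite (set_pmf (bernoulli_field A p))"
  by (subst set_Pi_pmf) (auto intro!: finite_PiE_dflt)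

text \<open>Conditioning on a single coordinate; this drives the inductions behind independence and
  Harris' inequality.\<close>

lemma prob_bernoulli_field_insert:
  assumes "finite A" "x \<notin> A" "0 \<le> p" "p \<le> 1"
  shows "measure_pmf.prob (bernoulli_field (insert x A) p) D =
     p * measure_pmf.prob (bernoulli_field A p) {f. f(x := True) \<in> D}
     + (1 - p) * measure_pmf.prob (bernoulli_field A p) {f. f(x := False) \<in> D}"
proof -
  have *: "bernoulli_field (insert x A) p =
      bernoulli_pmf p \<bind> (\<lambda>b. map_pmf (\<lambda>f. f(x := b)) (bernoulli_field A p))"
    using assms by (subst Pi_pmf_insert)
      (auto simp: pair_pmf_def map_pmf_def bind_assoc_pmf bind_return_pmf)
  have "measure_pmf.expectation (bernoulli_field (insert x A) p) (indicator D :: _ \<Rightarrow> real) =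
      (\<Sum>b\<in>UNIV. pmf (bernoulli_pmf p) b *\<^sub>R
        measure_pmf.expectation (map_pmf (\<lambda>f. f(x := b)) (bernoulli_field A p)) (indicator D))"
    unfolding * by (rule pmf_expectation_bind) (simp_all add: finite_set_bernoulli_field \<open>finite A\<close>)
  also have "\<dots> = p * measure_pmf.prob (map_pmf (\<lambda>f. f(x := True)) (bernoulli_field A p)) D
     + (1 - p) * measure_pmf.prob (map_pmf (\<lambda>f. f(x := False)) (bernoulli_field A p)) D"
    using assms by (simp add: UNIV_bool)
  finally show ?thesis by (simp add: vimage_def)
qed

text \<open>\<open>D\<close> is any event that ignores the coordinates in \<open>F\<close>. In this
  form a planted set of edges can be split off from the event that no other copy appears.\<close>

lemma prob_bernoulli_field_all_indep:
  assumes "finite A" "F \<subseteq> A" "0 \<le> p" "p \<le> 1"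
    and "\<And>f g. (\<And>x. x \<notin> F \<Longrightarrow> f x = g x) \<Longrightarrow> f \<in> D \<longleftrightarrow> g \<in> D"
  shows "measure_pmf.prob (bernoulli_field A p) {f\<in>D. \<forall>x\<in>F. f x} =
     p ^ card F * measure_pmf.prob (bernoulli_field A p) D"
proof -
  have "finite F" using assms finite_subset by blast
  then show ?thesis using assms(2,5)
  proof (induction F arbitrary: D)
    case empty
    show ?case by simp
  next
    case (insert x F)
    define E where "E = {f\<in>D. f x}"
    obtain B where B: "A = insert x B" "x \<notin> B"
      using insert.prems(1) by (meson insert_subset mk_disjoint_insert)
    have "{f \<in> D. \<forall>y\<in>insert x F. f y} = {f \<in> E. \<forall>y\<in>F. f y}" by (auto simp: E_def)
    also have "measure_pmf.prob (bernoulli_field A p) \<dots> = p ^ card F * measure_pmf.prob (bernoulli_field A p) E"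
    proof (rule insert.IH)
      fix f g :: "'a \<Rightarrow> bool"
      assume *: "\<And>y. y \<notin> F \<Longrightarrow> f y = g y"
      then have "f \<in> D \<longleftrightarrow> g \<in> D" by (intro insert.prems(2)) auto
      then show "f \<in> E \<longleftrightarrow> g \<in> E" using *[OF insert.hyps(2)] by (auto simp: E_def)
    qed (use insert.prems in auto)
    also have "measure_pmf.prob (bernoulli_field A p) E = p * measure_pmf.prob (bernoulli_field A p) D"
    proof -
      have "f(x := b) \<in> D \<longleftrightarrow> f \<in> D" for f b
        by (intro insert.prems(2)) auto
      then show ?thesis
        using assms(1,3,4) B by (simp add: prob_bernoulli_field_insert E_def algebra_simps)
    qed
    finally show ?case using insert.hyps by simp
  qed
qed

lemma prob_bernoulli_field_all:
  assumes "finite A" "F \<subseteq> A" "0 \<le> p" "p \<le> 1"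
  shows "measure_pmf.prob (bernoulli_field A p) {f. \<forall>x\<in>F. f x} = p ^ card F"
  using prob_bernoulli_field_all_indep[OF assms, of UNIV] by simp

text \<open>Condition on one coordinate. The sections of both events satisfy the claim by induction,
  and their probabilities decrease together in that coordinate, so the average of the products is at
  least the product of the averages (Chebyshev's sum inequality).\<close>

lemma harris_inequality:
  assumes "finite A" "0 \<le> p" "p \<le> 1"
    and "\<And>f g. f \<le> g \<Longrightarrow> g \<in> D \<Longrightarrow> f \<in> D"
    and "\<And>f g. f \<le> g \<Longrightarrow> g \<in> E \<Longrightarrow> f \<in> E"
  shows "measure_pmf.prob (bernoulli_field A p) (D \<inter> E) \<ge>
     measure_pmf.prob (bernoulli_field A p) D * measure_pmf.prob (bernoulli_field A p) E"
  using assms(1,4,5)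
proof (induction A arbitrary: D E)
  case empty
  show ?case by (simp add: indicator_def)
next
  case (insert x A)
  let ?P = "measure_pmf.prob (bernoulli_field A p)"
  define S where "S b D = {f. f(x := b) \<in> D}" for b and D :: "('a \<Rightarrow> bool) set"
  have split: "measure_pmf.prob (bernoulli_field (insert x A) p) D = p * ?P (S True D) + (1 - p) * ?P (S False D)" for D
    unfolding S_def by (rule prob_bernoulli_field_insert) (use insert assms in auto)
  have mono: "?P (S b D) * ?P (S b E) \<le> ?P (S b (D \<inter> E))" for b
  proof -
    have "S b (D \<inter> E) = S b D \<inter> S b E" by (auto simp: S_def)
    moreover have upd: "f(x := b) \<le> g(x := b)" if "f \<le> g" for f g :: "'a \<Rightarrow> bool"
      using that by (auto simp: le_fun_def)
    have "?P (S b D) * ?P (S b E) \<le> ?P (S b D \<inter> S b E)"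
    proof (rule insert.IH)
      show "f \<in> S b D" if "f \<le> g" "g \<in> S b D" for f g
        using insert.prems(1)[OF upd[OF that(1)]] that(2) unfolding S_def mem_Collect_eq .
      show "f \<in> S b E" if "f \<le> g" "g \<in> S b E" for f g
        using insert.prems(2)[OF upd[OF that(1)]] that(2) unfolding S_def mem_Collect_eq .
    qed
    ultimately show ?thesis by simp
  qed
  have le: "?P (S True D) \<le> ?P (S False D)" if "\<And>f g. f \<le> g \<Longrightarrow> g \<in> D \<Longrightarrow> f \<in> D" for D
  proof (intro measure_pmf.finite_measure_mono subsetI)
    fix f assume "f \<in> S True D"
    moreover have "f(x := False) \<le> f(x := True)" by (auto simp: le_fun_def)
    ultimately show "f \<in> S False D" using that unfolding S_def by blast
  qed auto
  let ?a = "?P (S True D)" and ?b = "?P (S False D)" and ?c = "?P (S True E)" and ?d = "?P (S False E)"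
  \<comment> \<open>This quantity is exactly the right side minus the left side of the next
    inequality.\<close>
  have "0 \<le> p * (1 - p) * ((?b - ?a) * (?d - ?c))"
    using le[OF insert.prems(1)] le[OF insert.prems(2)] assms by simp
  then have "(p * ?a + (1 - p) * ?b) * (p * ?c + (1 - p) * ?d) \<le> p * (?a * ?c) + (1 - p) * (?b * ?d)"
    by (simp add: algebra_simps)
  also have "\<dots> \<le> p * ?P (S True (D \<inter> E)) + (1 - p) * ?P (S False (D \<inter> E))"
    using mono assms by (intro add_mono mult_left_mono) auto
  finally show ?case unfolding split .
qed

text \<open>The events that some element of \<open>T i\<close> is missing are all decreasing, so
  Harris' inequality multiplies them although the sets \<open>T i\<close> may overlap.\<close>

lemma prob_bernoulli_field_none_contained:
  assumes "finite A" "0 \<le> p" "p \<le> 1" "finite I" "\<And>i. i \<in> I \<Longrightarrow> T i \<subseteq> A"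
  shows "measure_pmf.prob (bernoulli_field A p) {f. \<forall>i\<in>I. \<exists>x\<in>T i. \<not> f x} \<ge> (\<Prod>i\<in>I. 1 - p ^ card (T i))"
  using assms(4,5)
proof (induction I)
  case empty
  then show ?case by simp
next
  case (insert i I)
  let ?P = "measure_pmf.prob (bernoulli_field A p)"
  have "?P {f. \<exists>x\<in>T i. \<not> f x} = 1 - ?P {f. \<forall>x\<in>T i. f x}"
    by (subst measure_pmf.prob_compl[symmetric]) (auto intro!: arg_cong[where f = ?P])
  also have "?P {f. \<forall>x\<in>T i. f x} = p ^ card (T i)"
    using insert.prems assms by (intro prob_bernoulli_field_all) auto
  finally have 1: "?P {f. \<exists>x\<in>T i. \<not> f x} = 1 - p ^ card (T i)" .
  have "(\<Prod>i\<in>insert i I. 1 - p ^ card (T i)) \<le> ?P {f. \<exists>x\<in>T i. \<not> f x} * ?P {f. \<forall>i\<in>I. \<exists>x\<in>T i. \<not> f x}"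
    unfolding 1 using insert assms by (auto intro!: mult_left_mono simp: power_le_one)
  also have "\<dots> \<le> ?P ({f. \<exists>x\<in>T i. \<not> f x} \<inter> {f. \<forall>i\<in>I. \<exists>x\<in>T i. \<not> f x})"
  proof (rule harris_inequality)
    fix f g :: "'a \<Rightarrow> bool"
    assume "f \<le> g"
    then have *: "\<not> f x" if "\<not> g x" for x using that by (auto simp: le_fun_def)
    show "f \<in> {f. \<exists>x\<in>T i. \<not> f x}" if "g \<in> {f. \<exists>x\<in>T i. \<not> f x}"
      using that * by blast
    show "f \<in> {f. \<forall>i\<in>I. \<exists>x\<in>T i. \<not> f x}" if "g \<in> {f. \<forall>i\<in>I. \<exists>x\<in>T i. \<not> f x}"
      using that * by blast
  qed (use assms in auto)
  also have "{f. \<exists>x\<in>T i. \<not> f x} \<inter> {f. \<forall>i\<in>I. \<exists>x\<in>T i. \<not> f x} = {f. \<forall>i\<in>insert i I. \<exists>x\<in>T i. \<not> f x}"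
    by auto
  finally show ?case .
qed

section \<open>Copies of a connected regular graph\<close>

definition degree_in :: "'a set set \<Rightarrow> 'a \<Rightarrow> nat" where
  "degree_in F w = card {e\<in>F. w \<in> e}"

lemma sum_degree_in:
  assumes "finite F" "\<And>e. e \<in> F \<Longrightarrow> card e = 2" "finite V" "\<Union>F \<subseteq> V"
  shows "(\<Sum>w\<in>V. degree_in F w) = 2 * card F"
  unfolding degree_in_def
proof (rule sum_multicount[OF assms(3,1)], intro ballI)
  fix e assume e: "e \<in> F"
  then have "{w\<in>V. w \<in> e} = e" using assms(4) by blast
  then show "card {w\<in>V. w \<in> e} = 2" using assms(2)[OF e] by simp
qed

text \<open>A path from inside \<open>R\<close> to outside has to cross the boundary. Connectivity
  is mostly used through such a crossing edge.\<close>

lemma connected_graph_cut: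
  assumes "connected_graph G" "a \<in> verts G" "a \<in> R" "b \<in> verts G" "b \<notin> R"
  obtains x y where "{x, y} \<in> edges G" "x \<in> R" "y \<notin> R"
proof -
  have "(a, b) \<in> {(x, y). {x, y} \<in> edges G}\<^sup>*"
    using assms unfolding connected_graph_def by blast
  then have "b \<notin> R \<Longrightarrow> \<exists>x y. {x, y} \<in> edges G \<and> x \<in> R \<and> y \<notin> R"
    by (induction rule: rtrancl_induct) (use assms(3) in auto)
  then show ?thesis using assms(5) that by blast
qed

text \<open>Isomorphism is defined by comparing pairs \<open>{u, v}\<close>. As both graphs are
  simple, every edge is such a pair, so the bijection carries one edge set onto the other.\<close>

lemma isomorphic_graphs_imageE:
  assumes "isomorphic_graphs G K" "simple_graph G" "simple_graph K"
  obtains f where "bij_betw f (verts G) (verts K)" "edges K = (`) f ` edges G"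
proof -
  obtain f where f: "bij_betw f (verts G) (verts K)"
    and e: "\<And>u w. u \<in> verts G \<Longrightarrow> w \<in> verts G \<Longrightarrow> {u, w} \<in> edges G \<longleftrightarrow> {f u, f w} \<in> edges K"
    using assms(1) unfolding isomorphic_graphs_def by blast
  have "edges K = (`) f ` edges G"
  proof (intro equalityI subsetI)
    fix x assume x: "x \<in> edges K"
    then have "x \<subseteq> verts K" "card x = 2"
      using assms(3) by (auto simp: simple_graph_def all_pairs_def)
    then obtain a b where ab: "x = {a, b}" "a \<in> verts K" "b \<in> verts K"
      by (auto simp: card_2_iff)
    then obtain u w where "u \<in> verts G" "w \<in> verts G" "a = f u" "b = f w"
      using f unfolding bij_betw_def by (metis imageE)
    with e[of u w] x ab have "{u, w} \<in> edges G" "x = f ` {u, w}" by auto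
    then show "x \<in> (`) f ` edges G" by blast
  next
    fix x assume "x \<in> (`) f ` edges G"
    then obtain y where y: "y \<in> edges G" "x = f ` y" by blast
    then have "y \<subseteq> verts G" "card y = 2"
      using assms(2) by (auto simp: simple_graph_def all_pairs_def)
    then obtain a b where "y = {a, b}" "a \<in> verts G" "b \<in> verts G"
      by (auto simp: card_2_iff)
    then show "x \<in> edges K" using e[of a b] y by auto
  qed
  with f show ?thesis using that by blast
qed

text \<open>Every copy of \<open>H\<close> is again an instance, by \<open>isomorphic_copy\<close>,
  so facts about copies come from interpreting the locale at them.\<close>

locale connected_regular_graph =
  fixes H :: "'a graph" and \<Delta> :: nat
  assumes degree_ge_2: "\<Delta> \<ge> 2"
    and finite_verts: "finite (verts H)"
    and simple: "simple_graph H"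
    and connected: "connected_graph H"
    and regular: "regular_graph \<Delta> H"
begin

lemma edge_subset: "e \<in> edges H \<Longrightarrow> e \<subseteq> verts H"
  and card_edge: "e \<in> edges H \<Longrightarrow> card e = 2"
  using simple by (auto simp: simple_graph_def all_pairs_def)

lemma finite_edges: "finite (edges H)"
  using finite_verts edge_subset by (meson Pow_iff finite_Pow_iff finite_subset subsetI)

lemma degree_in_edges: "w \<in> verts H \<Longrightarrow> degree_in (edges H) w = \<Delta>"
  using regular by (simp add: regular_graph_def degree_in_def)

text \<open>The degree is positive, so there are no isolated vertices. Hence such a graph is
  determined by its edges, and copies can be compared through their edge sets.\<close>

lemma Union_edges: "\<Union>(edges H) = verts H"
proof (intro equalityI subsetI)
  fix w assume w: "w \<in> verts H"
  then have "{e \<in> edges H. w \<in> e} \<noteq> {}"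
    using degree_in_edges[OF w] degree_ge_2 unfolding degree_in_def
    by (metis card.empty not_numeral_le_zero)
  then show "w \<in> \<Union>(edges H)" by blast
qed (use edge_subset in auto)

lemma handshake: "2 * card (edges H) = \<Delta> * card (verts H)"
proof -
  have "(\<Sum>w\<in>verts H. degree_in (edges H) w) = 2 * card (edges H)"
    by (rule sum_degree_in) (use finite_edges card_edge finite_verts Union_edges in auto)
  then show ?thesis by (simp add: degree_in_edges mult.commute)
qed

text \<open>Two distinct edges at one vertex span at least three vertices. This makes the
  denominator \<open>v - 2\<close> in the exponent of the logarithm positive.\<close>

lemma card_verts_ge_3: "card (verts H) \<ge> 3"
proof -
  obtain w where w: "w \<in> verts H" using connected by (auto simp: connected_graph_def)
  have "card {e \<in> edges H. w \<in> e} \<ge> 2"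
    using degree_in_edges[OF w] degree_ge_2 by (simp add: degree_in_def)
  then obtain T where "T \<subseteq> {e \<in> edges H. w \<in> e}" "card T = 2"
    by (meson obtain_subset_with_card_n)
  then obtain x y where xy: "x \<in> edges H" "y \<in> edges H" "w \<in> x" "w \<in> y" "x \<noteq> y"
    by (auto simp: card_2_iff)
  have "finite x" "finite y" using xy card_edge by (metis card.infinite zero_neq_numeral)+
  then have "card x < card (x \<union> y)"
    using xy card_edge
    by (intro psubset_card_mono) (auto simp: psubset_eq, metis card_subset_eq sup_ge2 sup.orderE sup_commute)
  also have "\<dots> \<le> card (verts H)"
    using xy edge_subset finite_verts by (intro card_mono) auto
  finally show ?thesis using card_edge[OF xy(1)] by simp
qed

lemma edges_nonempty: "card (edges H) > 0"
  using handshake degree_ge_2 card_verts_ge_3 by (metis gr0I mult_is_0 not_numeral_le_zero)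

lemma isomorphic_copy:
  assumes "isomorphic_graphs H K" "simple_graph K"
  shows "connected_regular_graph K \<Delta>"
    and "card (verts K) = card (verts H)" and "card (edges K) = card (edges H)"
proof -
  obtain f where f: "bij_betw f (verts H) (verts K)" "edges K = (`) f ` edges H"
    using isomorphic_graphs_imageE[OF assms(1) simple assms(2)] by blast
  have inj: "inj_on f (verts H)" and im: "f ` verts H = verts K"
    using f by (auto simp: bij_betw_def)
  have inj2: "inj_on ((`) f) (edges H)"
    by (rule inj_on_subset[OF inj_on_image_Pow[OF inj]]) (use edge_subset in auto)
  show "card (verts K) = card (verts H)" "card (edges K) = card (edges H)"
    using card_image[OF inj] card_image[OF inj2] im f by auto
  show "connected_regular_graph K \<Delta>"
  proof
    show "\<Delta> \<ge> 2" by (rule degree_ge_2)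
    show "simple_graph K" by (rule assms)
    show "finite (verts K)" using finite_verts im by (metis finite_imageI)
    have path: "(f u, f w) \<in> {(x, y). {x, y} \<in> edges K}\<^sup>*"
      if "(u, w) \<in> {(x, y). {x, y} \<in> edges H}\<^sup>*" for u w
      using that
    proof (induction rule: rtrancl_induct)
      case (step y z)
      then have "f ` {y, z} \<in> edges K" unfolding f(2) by blast
      then show ?case using step by (auto intro: rtrancl_into_rtrancl)
    qed simp
    show "connected_graph K"
      using connected path unfolding connected_graph_def im[symmetric] by auto
    show "regular_graph \<Delta> K"
      unfolding regular_graph_def
    proof
      fix x assume "x \<in> verts K"
      then obtain w where w: "w \<in> verts H" "x = f w" using im by blast
      have "{e \<in> edges K. x \<in> e} = (`) f ` {e \<in> edges H. w \<in> e}"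
      proof (intro equalityI subsetI)
        fix e assume "e \<in> {e \<in> edges K. x \<in> e}"
        then obtain g where g: "g \<in> edges H" "e = f ` g" "f w \<in> f ` g" using f w by auto
        then have "w \<in> g" using inj w(1) edge_subset[OF g(1)] by (meson inj_on_image_mem_iff)
        then show "e \<in> (`) f ` {e \<in> edges H. w \<in> e}" using g by blast
      qed (use f w in auto)
      also have "card \<dots> = card {e \<in> edges H. w \<in> e}"
        by (rule card_image) (use inj2 in \<open>auto intro: inj_on_subset\<close>)
      finally show "card {e \<in> edges K. x \<in> e} = \<Delta>"
        using degree_in_edges[OF w(1)] by (simp add: degree_in_def)
    qed
  qed
qed

lemma copy_props:
  assumes "K \<in> copies H G"
  shows "connected_regular_graph K \<Delta>"
    and "card (verts K) = card (verts H)" "card (edges K) = card (edges H)"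
    and "verts K \<subseteq> verts G" "edges K \<subseteq> edges G"
  using assms isomorphic_copy[of K] by (auto simp: copies_def subgraph_def)

text \<open>Reduces counting copies to counting maps: distinct copies need distinct maps, whereas
  one copy may come from several. The maps are extensional so that they form a finite set.\<close>

lemma copies_subset_image:
  "copies H G \<subseteq> (\<lambda>f. (f ` verts H, (`) f ` edges H)) `
     {f \<in> verts H \<rightarrow>\<^sub>E verts G. inj_on f (verts H) \<and> (`) f ` edges H \<subseteq> edges G}"
proof
  fix K assume K: "K \<in> copies H G"
  then have s: "isomorphic_graphs H K" "simple_graph K" by (auto simp: copies_def subgraph_def)
  obtain f where f: "bij_betw f (verts H) (verts K)" "edges K = (`) f ` edges H"
    using isomorphic_graphs_imageE[OF s(1) simple s(2)] by blast
  let ?g = "restrict f (verts H)"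
  have g1: "?g ` e = f ` e" if "e \<subseteq> verts H" for e
    using that by auto
  then have "(`) ?g ` edges H = (`) f ` edges H"
    using edge_subset by (intro image_cong) auto
  then have "K = (?g ` verts H, (`) ?g ` edges H)"
    using f g1[of "verts H"] by (auto simp: bij_betw_def prod_eq_iff)
  moreover have "?g \<in> verts H \<rightarrow>\<^sub>E verts G" "inj_on ?g (verts H)" "(`) ?g ` edges H \<subseteq> edges G"
    using copy_props(4,5)[OF K] f \<open>(`) ?g ` edges H = (`) f ` edges H\<close>
    by (auto simp: bij_betw_def)
  ultimately show "K \<in> (\<lambda>f. (f ` verts H, (`) f ` edges H)) `
     {f \<in> verts H \<rightarrow>\<^sub>E verts G. inj_on f (verts H) \<and> (`) f ` edges H \<subseteq> edges G}"
    by blast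
qed

lemma finite_copies:
  assumes "finite (verts G)"
  shows "finite (copies H G)"
proof (rule finite_subset[OF copies_subset_image], rule finite_imageI)
  show "finite {f \<in> verts H \<rightarrow>\<^sub>E verts G. inj_on f (verts H) \<and> (`) f ` edges H \<subseteq> edges G}"
    by (rule finite_subset[of _ "verts H \<rightarrow>\<^sub>E verts G"]) (auto intro!: finite_PiE finite_verts assms)
qed

text \<open>The exponent \<open>v/2\<close> comes from Finner's inequality with one factor per edge of \<open>H\<close>:
  every vertex of \<open>H\<close> lies in exactly \<open>\<Delta>\<close> of them.\<close>

lemma card_copies_le:
  assumes "finite (verts G)" "simple_graph G"
  shows "card (copies H G) ^ 2 \<le> (2 * card (edges G)) ^ card (verts H)"
proof -
  let ?V = "verts H" and ?E = "edges H" and ?A = "verts G" and ?F = "edges G"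
  have finF: "finite ?F"
    using assms by (metis (mono_tags) simple_graph_def all_pairs_def finite_Collect_subsets finite_Collect_conjI finite_subset)
  have cF: "card x = 2" if "x \<in> ?F" for x
    using assms that by (auto simp: simple_graph_def all_pairs_def)
  let ?hom = "{f \<in> ?V \<rightarrow>\<^sub>E ?A. (`) f ` ?E \<subseteq> ?F}"
  have finP: "finite (?V \<rightarrow>\<^sub>E ?A)" using assms finite_verts by (simp add: finite_PiE)
  have "card (copies H G) \<le> card ?hom"
    by (rule surj_card_le) (use copies_subset_image[of G] finP in auto)
  let ?h = "\<lambda>e y. of_bool (y ` e \<in> ?F) :: real"
  have pos: "\<Delta> > 0" using degree_ge_2 by simp
  have "real (card ?hom) = (\<Sum>f\<in>?V \<rightarrow>\<^sub>E ?A. of_bool (f \<in> ?hom))"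
    using finP by (simp add: sum.If_cases of_bool_def Int_def)
  \<comment> \<open>Being a homomorphism factors over the edges of \<open>H\<close>, and a factor
    that is 0 or 1 equals its own root; this is the shape that Finner's inequality requires.\<close>
  also have "\<dots> = (\<Sum>f\<in>?V \<rightarrow>\<^sub>E ?A. \<Prod>e\<in>?E. root \<Delta> (?h e (restrict f e)))"
  proof (intro sum.cong refl)
    fix f assume f: "f \<in> ?V \<rightarrow>\<^sub>E ?A"
    show "of_bool (f \<in> ?hom) = (\<Prod>e\<in>?E. root \<Delta> (?h e (restrict f e)))"
    proof (cases "f \<in> ?hom")
      case True
      then show ?thesis using pos by (auto intro!: prod.neutral)
    next
      case False
      then obtain e where "e \<in> ?E" "f ` e \<notin> ?F" using f by blast
      then show ?thesis using False finite_edges by (auto intro!: bexI[of _ e])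
    qed
  qed
  also have "\<dots> \<le> (\<Prod>e\<in>?E. root \<Delta> (\<Sum>y\<in>e \<rightarrow>\<^sub>E ?A. ?h e y))"
    by (rule finner_inequality)
      (use finite_verts finite_edges assms pos edge_subset degree_in_edges in \<open>auto simp: degree_in_def\<close>)
  also have "\<dots> \<le> (\<Prod>e\<in>?E. root \<Delta> (2 * real (card ?F)))"
  proof (intro prod_mono conjI)
    fix e assume e: "e \<in> ?E"
    show "0 \<le> root \<Delta> (\<Sum>y\<in>e \<rightarrow>\<^sub>E ?A. ?h e y)" using pos by (auto intro!: sum_nonneg)
    obtain a b where ab: "e = {a, b}" "a \<noteq> b" using card_edge[OF e] by (auto simp: card_2_iff)
    have finPe: "finite (e \<rightarrow>\<^sub>E ?A)" using assms ab by (simp add: finite_PiE)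
    have "(\<Sum>y\<in>e \<rightarrow>\<^sub>E ?A. ?h e y) = card {y \<in> e \<rightarrow>\<^sub>E ?A. y ` e \<in> ?F}"
      using finPe by (simp add: sum.If_cases of_bool_def Int_def)
    \<comment> \<open>A map of one edge of \<open>H\<close> onto an edge of \<open>G\<close> is
      determined by the image edge and the image of one endpoint, whence the factor 2.\<close>
    also have "card {y \<in> e \<rightarrow>\<^sub>E ?A. y ` e \<in> ?F} \<le> card (Sigma ?F (\<lambda>x. x))"
    proof (rule card_inj_on_le[of "\<lambda>y. (y ` e, y a)"])
      show "inj_on (\<lambda>y. (y ` e, y a)) {y \<in> e \<rightarrow>\<^sub>E ?A. y ` e \<in> ?F}"
      proof (rule inj_onI)
        fix y z assume y: "y \<in> {y \<in> e \<rightarrow>\<^sub>E ?A. y ` e \<in> ?F}" and z: "z \<in> {y \<in> e \<rightarrow>\<^sub>E ?A. y ` e \<in> ?F}"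
          and eq: "(y ` e, y a) = (z ` e, z a)"
        have "card (y ` e) = 2" using y cF by auto
        then have "y a \<noteq> y b" using ab by auto
        then have "y b = z b" using eq ab by (auto simp: doubleton_eq_iff)
        then show "y = z" using y z eq ab by (intro PiE_ext[of y e "\<lambda>_. ?A" z]) auto
      qed
      show "finite (Sigma ?F (\<lambda>x. x))"
        using finF cF by (intro finite_SigmaI) (auto intro: card_ge_0_finite)
    qed (use ab in auto)
    also have "card (Sigma ?F (\<lambda>x. x)) = 2 * card ?F"
      using finF cF by (subst card_SigmaI) (auto intro: card_ge_0_finite)
    finally show "root \<Delta> (\<Sum>y\<in>e \<rightarrow>\<^sub>E ?A. ?h e y) \<le> root \<Delta> (2 * real (card ?F))"
      using pos by simp
  qed
  finally have "real (card ?hom) \<le> root \<Delta> (2 * real (card ?F)) ^ card ?E" by simp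
  then have "real (card ?hom) ^ 2 \<le> (root \<Delta> (2 * real (card ?F)) ^ card ?E) ^ 2"
    by (intro power_mono) auto
  \<comment> \<open>Each of the \<open>card ?E\<close> factors has exponent
    \<open>1 / \<Delta>\<close>; after squaring, the handshake identity turns the total exponent
    into \<open>card ?V\<close>.\<close>
  also have "\<dots> = (root \<Delta> (2 * real (card ?F)) ^ \<Delta>) ^ card ?V"
    unfolding power_mult[symmetric] using handshake by (simp add: mult.commute)
  also have "\<dots> = real ((2 * card ?F) ^ card ?V)" using pos by simp
  finally have "card ?hom ^ 2 \<le> (2 * card ?F) ^ card ?V"
    by (simp flip: of_nat_power of_nat_mult add: of_nat_le_iff)
  then show ?thesis
    using \<open>card (copies H G) \<le> card ?hom\<close> by (meson le_trans power_mono zero_le)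
qed

end

section \<open>Rigidity of regular subgraphs and the edge excess of overlapping copies\<close>

lemma degree_in_eq_imp_edge_subset:
  assumes "connected_regular_graph K \<Delta>" "finite F" "edges K \<subseteq> F"
    and "w \<in> verts K" "degree_in F w = \<Delta>" "e \<in> F" "w \<in> e"
  shows "e \<in> edges K"
proof -
  interpret K: connected_regular_graph K \<Delta> by fact
  have "{e \<in> edges K. w \<in> e} = {e \<in> F. w \<in> e}"
    using assms K.degree_in_edges[OF assms(4)] by (intro card_subset_eq) (auto simp: degree_in_def)
  then show ?thesis using assms by blast
qed

text \<open>If every vertex of \<open>K\<close> has degree \<open>\<Delta>\<close> in
  \<open>F\<close>, then no other edge of \<open>F\<close> touches \<open>K\<close>. A connected
  \<open>L\<close> that meets \<open>K\<close> therefore stays inside it, and equal numbers of edges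
  force equality.\<close>

lemma saturated_copy_unique:
  assumes "connected_regular_graph K \<Delta>" "connected_regular_graph L \<Delta>"
    and "finite F" "edges K \<subseteq> F" "edges L \<subseteq> F" "card (edges K) = card (edges L)"
    and sat: "\<And>w. w \<in> verts K \<Longrightarrow> degree_in F w = \<Delta>"
    and "verts K \<inter> verts L \<noteq> {}"
  shows "K = L"
proof -
  interpret K: connected_regular_graph K \<Delta> by fact
  interpret L: connected_regular_graph L \<Delta> by fact
  have absorb: "e \<in> edges K" if "e \<in> edges L" "w \<in> verts K" "w \<in> e" for e w
    using degree_in_eq_imp_edge_subset[OF assms(1,3,4) that(2) sat[OF that(2)]] that assms(5) by blast
  obtain a where a: "a \<in> verts K" "a \<in> verts L" using assms(8) by blast
  have "verts L \<subseteq> verts K"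
  proof
    fix b assume "b \<in> verts L"
    show "b \<in> verts K"
    proof (rule ccontr)
      assume "b \<notin> verts K"
      then obtain x y where "{x, y} \<in> edges L" "x \<in> verts K" "y \<notin> verts K"
        using connected_graph_cut[OF L.connected a(2,1) \<open>b \<in> verts L\<close>] by blast
      then show False using absorb[of "{x, y}" x] K.edge_subset by blast
    qed
  qed
  have "edges L \<subseteq> edges K"
  proof
    fix e assume e: "e \<in> edges L"
    then have "e \<noteq> {}" using L.card_edge by fastforce
    then obtain w where "w \<in> e" by blast
    then show "e \<in> edges K"
      using absorb[OF e] L.edge_subset[OF e] \<open>verts L \<subseteq> verts K\<close> by blast
  qed
  then have "edges L = edges K"
    using K.finite_edges assms(6) by (intro card_subset_eq) auto
  then show ?thesis
    using K.Union_edges L.Union_edges by (simp add: prod_eq_iff)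
qed

text \<open>A vertex of degree more than \<open>\<Delta>\<close> is reached from every vertex along a path whose other
  vertices have degree exactly \<open>\<Delta>\<close>, and such paths of length at most \<open>v\<close> meet only boundedly
  many vertices per edge at the high degree vertices.\<close>

lemma overlapping_copies_excess:
  fixes \<K> :: "'a graph set"
  assumes "finite \<K>"
    and reg: "\<And>K. K \<in> \<K> \<Longrightarrow> connected_regular_graph K \<Delta>"
    and vK: "\<And>K. K \<in> \<K> \<Longrightarrow> card (verts K) = v"
    and hK: "\<And>K. K \<in> \<K> \<Longrightarrow> card (edges K) = h"
    and overlap: "\<And>K. K \<in> \<K> \<Longrightarrow> \<exists>L\<in>\<K>. L \<noteq> K \<and> verts K \<inter> verts L \<noteq> {}"
    and F: "F = \<Union>(edges ` \<K>)"
  shows "2 * card F + (1 + \<Delta>) ^ (v + 1) * (\<Delta> * card (\<Union>F)) \<le> (1 + \<Delta>) ^ (v + 1) * (2 * card F)"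
proof -
  define V where "V = \<Union>F"
  let ?d = "degree_in F"
  \<comment> \<open>The difference between \<open>2 * card F\<close> and
    \<open>\<Delta> * card V\<close> is carried by these vertices alone.\<close>
  define B where "B = {w \<in> V. ?d w > \<Delta>}"
  have finF: "finite F"
    unfolding F using \<open>finite \<K>\<close> connected_regular_graph.finite_edges[OF reg] by blast
  have cF: "card e = 2" if "e \<in> F" for e
    using that connected_regular_graph.card_edge[OF reg] unfolding F by blast
  have finE: "finite e" if "e \<in> F" for e
    using cF[OF that] by (intro card_ge_0_finite) simp
  have finV: "finite V"
    unfolding V_def using finF finE by (intro finite_Union)
  have sub: "edges K \<subseteq> F" "verts K \<subseteq> V" if "K \<in> \<K>" for K
    using that connected_regular_graph.Union_edges[OF reg[OF that]] unfolding V_def F by blast+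
  have cover: "\<exists>K\<in>\<K>. w \<in> verts K" if "w \<in> V" for w
    using that connected_regular_graph.edge_subset[OF reg] unfolding V_def F by blast
  have degV: "?d w \<ge> \<Delta>" if w: "w \<in> V" for w
  proof -
    obtain K where K: "K \<in> \<K>" "w \<in> verts K" using cover[OF w] by blast
    have "degree_in (edges K) w \<le> ?d w"
      unfolding degree_in_def using sub(1)[OF K(1)] finF by (intro card_mono) auto
    then show ?thesis
      using connected_regular_graph.degree_in_edges[OF reg[OF K(1)] K(2)] by simp
  qed
  \<comment> \<open>If all vertices of \<open>K\<close> had degree \<open>\<Delta>\<close> in
    \<open>F\<close>, rigidity would identify \<open>K\<close> with the copy overlapping it.\<close>
  have hitB: "verts K \<inter> B \<noteq> {}" if K: "K \<in> \<K>" for K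
  proof
    assume *: "verts K \<inter> B = {}"
    obtain L where L: "L \<in> \<K>" "L \<noteq> K" "verts K \<inter> verts L \<noteq> {}" using overlap[OF K] by blast
    have "?d w = \<Delta>" if "w \<in> verts K" for w
      using * degV sub(2)[OF K] that unfolding B_def by (metis (mono_tags, lifting) disjoint_iff le_neq_implies_less mem_Collect_eq subsetD)
    then have "K = L"
      using saturated_copy_unique[OF reg[OF K] reg[OF L(1)] finF sub(1)[OF K] sub(1)[OF L(1)]]
        hK[OF K] hK[OF L(1)] L(3) by simp
    with L show False by simp
  qed
  \<comment> \<open>A new vertex has degree exactly \<open>\<Delta>\<close>, so it adds
    \<open>\<Delta>\<close> to the degree sum and can be charged to an edge at \<open>R\<close>. One
    round thus multiplies the degree sum by at most \<open>1 + \<Delta>\<close>.\<close>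
  define N where "N R = {w \<in> V - R. ?d w = \<Delta> \<and> (\<exists>x\<in>R. {x, w} \<in> F)}" for R
  define R where "R i = ((\<lambda>R. R \<union> N R) ^^ i) B" for i
  have R_Suc: "R (Suc i) = R i \<union> N (R i)" for i by (simp add: R_def)
  have R0: "R 0 = B" by (simp add: R_def)
  have RV: "R i \<subseteq> V" for i
    by (induction i) (auto simp: R_Suc R0 B_def N_def)
  have BR: "B \<subseteq> R i" for i
    by (induction i) (auto simp: R_Suc R0)
  have finR: "finite (R i)" for i using RV finV finite_subset by blast
  have grow: "sum ?d (R (Suc i)) \<le> (1 + \<Delta>) * sum ?d (R i)" for i
  proof -
    have "N (R i) \<subseteq> (\<Union>x\<in>R i. \<Union>e\<in>{e\<in>F. x \<in> e}. e - {x})"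
    proof
      fix w assume "w \<in> N (R i)"
      then obtain x where x: "x \<in> R i" "{x, w} \<in> F" "w \<notin> R i" by (auto simp: N_def)
      then have "w \<in> {x, w} - {x}" by auto
      then show "w \<in> (\<Union>x\<in>R i. \<Union>e\<in>{e\<in>F. x \<in> e}. e - {x})" using x by blast
    qed
    then have "card (N (R i)) \<le> card (\<Union>x\<in>R i. \<Union>e\<in>{e\<in>F. x \<in> e}. e - {x})"
      using finR finF finE by (intro card_mono) (auto intro!: finite_Union)
    also have "\<dots> \<le> (\<Sum>x\<in>R i. card (\<Union>e\<in>{e\<in>F. x \<in> e}. e - {x}))"
      by (rule card_UN_le[OF finR])
    also have "\<dots> \<le> (\<Sum>x\<in>R i. \<Sum>e\<in>{e\<in>F. x \<in> e}. card (e - {x}))"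
      using finF by (intro sum_mono card_UN_le) auto
    also have "\<dots> = sum ?d (R i)"
      using cF by (intro sum.cong) (auto simp: degree_in_def)
    finally have "card (N (R i)) \<le> sum ?d (R i)" .
    moreover have "sum ?d (R (Suc i)) = sum ?d (R i) + sum ?d (N (R i))"
      unfolding R_Suc using finR finV by (intro sum.union_disjoint) (auto simp: N_def)
    moreover have "sum ?d (N (R i)) = \<Delta> * card (N (R i))"
      by (simp add: N_def)
    ultimately show ?thesis by (simp add: mult_le_mono2)
  qed
  have sumR: "sum ?d (R i) \<le> (1 + \<Delta>) ^ i * sum ?d B" for i
  proof (induction i)
    case (Suc i)
    have "sum ?d (R (Suc i)) \<le> (1 + \<Delta>) * sum ?d (R i)" by (rule grow)
    also have "\<dots> \<le> (1 + \<Delta>) * ((1 + \<Delta>) ^ i * sum ?d B)" by (intro mult_le_mono2 Suc)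
    finally show ?case by (simp only: power_Suc mult.assoc)
  qed (simp add: R0)
  have "V \<subseteq> R v"
  proof
    fix w assume "w \<in> V"
    then obtain K where K: "K \<in> \<K>" "w \<in> verts K" using cover by blast
    interpret K: connected_regular_graph K \<Delta> using reg[OF K(1)] .
    \<comment> \<open>A copy not yet exhausted gains at least one vertex per round, since its
      vertices outside \<open>B\<close> have degree \<open>\<Delta>\<close>; hence \<open>v\<close>
      rounds reach all of \<open>V\<close>.\<close>
    have "min (i + 1) v \<le> card (verts K \<inter> R i)" for i
    proof (induction i)
      case 0
      have "card (verts K \<inter> R 0) > 0"
        using hitB[OF K(1)] K.finite_verts by (simp add: R0 card_gt_0_iff)
      then show ?case by simp
    next
      case (Suc i)
      show ?case
      proof (cases "verts K \<subseteq> R i")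
        case True
        then have "verts K \<inter> R (Suc i) = verts K" by (auto simp: R_Suc)
        then show ?thesis using vK[OF K(1)] by simp
      next
        case False
        then obtain b where b: "b \<in> verts K" "b \<notin> R i" by blast
        obtain a where a: "a \<in> verts K" "a \<in> R i" using hitB[OF K(1)] BR by blast
        obtain x y where xy: "{x, y} \<in> edges K" "x \<in> R i" "y \<notin> R i"
          using connected_graph_cut[OF K.connected a b] by blast
        have y: "y \<in> verts K" using K.edge_subset[OF xy(1)] by simp
        then have "y \<in> V" "y \<notin> B" using sub(2)[OF K(1)] BR xy by auto
        then have "?d y = \<Delta>" using degV[of y] by (simp add: B_def)
        then have "y \<in> N (R i)" using \<open>y \<in> V\<close> xy sub(1)[OF K(1)] by (auto simp: N_def)
        then have "verts K \<inter> R i \<subset> verts K \<inter> R (Suc i)" using y xy by (auto simp: R_Suc)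
        then have "card (verts K \<inter> R i) < card (verts K \<inter> R (Suc i))"
          using K.finite_verts by (intro psubset_card_mono) auto
        then show ?thesis using Suc by simp
      qed
    qed
    from this[of v] have "card (verts K) \<le> card (verts K \<inter> R v)" using vK[OF K(1)] by simp
    then have "verts K \<inter> R v = verts K"
      using K.finite_verts by (intro card_subset_eq) (auto intro!: antisym card_mono)
    then show "w \<in> R v" using K by blast
  qed
  then have "R v = V" using RV by blast
  have hs: "sum ?d V = 2 * card F"
    by (rule sum_degree_in) (use finF cF finV in \<open>auto simp: V_def\<close>)
  \<comment> \<open>The total excess. The truncated subtraction is exact by
    \<open>degV\<close>.\<close>
  define D where "D = (\<Sum>w\<in>V. ?d w - \<Delta>)"
  have "D + \<Delta> * card V = (\<Sum>w\<in>V. ?d w - \<Delta> + \<Delta>)" by (simp add: D_def sum.distrib)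
  also have "\<dots> = sum ?d V" by (intro sum.cong) (use degV in auto)
  finally have D: "D + \<Delta> * card V = 2 * card F" using hs by simp
  \<comment> \<open>A degree exceeding \<open>\<Delta>\<close> by at least 1 is at most
    \<open>1 + \<Delta>\<close> times its excess. Together with the \<open>v\<close> rounds this
    produces the exponent \<open>v + 1\<close>.\<close>
  have "sum ?d B \<le> (\<Sum>w\<in>B. (1 + \<Delta>) * (?d w - \<Delta>))"
  proof (rule sum_mono)
    fix w assume "w \<in> B"
    then obtain k where "?d w = \<Delta> + Suc k" unfolding B_def by (metis (mono_tags, lifting) less_imp_Suc_add mem_Collect_eq add_Suc_right)
    then show "?d w \<le> (1 + \<Delta>) * (?d w - \<Delta>)" by simp
  qed
  also have "\<dots> = (1 + \<Delta>) * (\<Sum>w\<in>B. ?d w - \<Delta>)" by (simp only: sum_distrib_left)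
  also have "\<dots> \<le> (1 + \<Delta>) * D"
    unfolding D_def by (intro mult_le_mono2 sum_mono2) (use finV in \<open>auto simp: B_def\<close>)
  finally have "sum ?d B \<le> (1 + \<Delta>) * D" .
  then have "2 * card F \<le> (1 + \<Delta>) ^ v * ((1 + \<Delta>) * D)"
    using sumR[of v] unfolding \<open>R v = V\<close> hs by (meson le_trans mult_le_mono2)
  then have "2 * card F \<le> (1 + \<Delta>) ^ (v + 1) * D" by (simp add: algebra_simps)
  then have "2 * card F + (1 + \<Delta>) ^ (v + 1) * (\<Delta> * card V) \<le>
      (1 + \<Delta>) ^ (v + 1) * D + (1 + \<Delta>) ^ (v + 1) * (\<Delta> * card V)" by simp
  also have "\<dots> = (1 + \<Delta>) ^ (v + 1) * (2 * card F)"
    unfolding D[symmetric] by (simp only: distrib_left)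
  finally show ?thesis by (simp add: V_def)
qed

section \<open>Upper bounds for the upper tail\<close>

lemma finite_all_pairs: "finite V \<Longrightarrow> finite (all_pairs V)"
  unfolding all_pairs_def by (rule finite_subset[of _ "Pow V"]) auto

lemma card_all_pairs: "finite V \<Longrightarrow> card (all_pairs V) = card V choose 2"
  unfolding all_pairs_def by (rule n_subsets)

lemma binomial_le_power: "n choose k \<le> n ^ k"
  by (cases "k \<le> n") (auto simp: binomial_le_pow binomial_eq_0)

lemma prob_gnp: "measure_pmf.prob (gnp n p) A = measure_pmf.prob (bernoulli_field (all_pairs {1..n}) p)
    {\<omega>. ({1..n}, {e \<in> all_pairs {1..n}. \<omega> e}) \<in> A}"
  by (simp add: gnp_def vimage_def)

lemma prob_bernoulli_field_family_le:
  assumes "finite A" "0 \<le> p" "p \<le> 1" "finite Q" "\<And>F. F \<in> Q \<Longrightarrow> F \<subseteq> A"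
  shows "measure_pmf.prob (bernoulli_field A p) {\<omega>. \<exists>F\<in>Q. \<forall>e\<in>F. \<omega> e} \<le> (\<Sum>F\<in>Q. p ^ card F)"
proof -
  have "{\<omega>. \<exists>F\<in>Q. \<forall>e\<in>F. \<omega> e} = (\<Union>F\<in>Q. {\<omega>. \<forall>e\<in>F. \<omega> e})" by blast
  also have "measure_pmf.prob (bernoulli_field A p) \<dots> \<le>
      (\<Sum>F\<in>Q. measure_pmf.prob (bernoulli_field A p) {\<omega>. \<forall>e\<in>F. \<omega> e})"
    by (rule measure_pmf.finite_measure_subadditive_finite) (use \<open>finite Q\<close> in auto)
  also have "\<dots> = (\<Sum>F\<in>Q. p ^ card F)"
    by (intro sum.cong prob_bernoulli_field_all) (use assms in auto)
  finally show ?thesis .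
qed

section \<open>Copies in the complete graph and the expected count\<close>

context connected_regular_graph
begin

text \<open>The deterministic index set of potential copies; randomness only decides which of them
  have all their edges present.\<close>

definition complete_copies :: "nat \<Rightarrow> nat graph set" where
  "complete_copies n = copies H ({1..n}, all_pairs {1..n})"

lemma finite_complete_copies: "finite (complete_copies n)"
  unfolding complete_copies_def by (rule finite_copies) simp

lemma complete_copy_props:
  assumes "K \<in> complete_copies n"
  shows "connected_regular_graph K \<Delta>"
    and "card (verts K) = card (verts H)" "card (edges K) = card (edges H)"
    and "verts K \<subseteq> {1..n}" "edges K \<subseteq> all_pairs {1..n}"
  using copy_props[OF assms[unfolded complete_copies_def]] by auto

lemma copies_sample:
  "copies H ({1..n}, {e \<in> all_pairs {1..n}. \<omega> e}) = {K \<in> complete_copies n. \<forall>e\<in>edges K. \<omega> e}"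
  by (auto simp: copies_def complete_copies_def subgraph_def)

lemma Union_edges_complete_copies:
  assumes "S \<subseteq> complete_copies n"
  shows "\<Union>(edges ` S) \<subseteq> all_pairs {1..n}"
  using complete_copy_props(5) assms by blast

lemma card_Union_edges_disjoint:
  assumes "S \<subseteq> complete_copies n" "pairwise (\<lambda>K L. verts K \<inter> verts L = {}) S"
  shows "card (\<Union>(edges ` S)) = card (edges H) * card S"
proof -
  have fin: "finite S" using assms finite_complete_copies finite_subset by blast
  have "card (\<Union>(edges ` S)) = (\<Sum>K\<in>S. card (edges K))"
  proof (rule card_UN_disjoint[OF fin]; intro ballI impI)
    show "finite (edges K)" if "K \<in> S" for K
      using complete_copy_props(1) assms that by (meson connected_regular_graph.finite_edges subsetD)
    fix K L assume KL: "K \<in> S" "L \<in> S" "K \<noteq> L"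
    interpret K: connected_regular_graph K \<Delta> using complete_copy_props(1) assms KL by blast
    interpret L: connected_regular_graph L \<Delta> using complete_copy_props(1) assms KL by blast
    show "edges K \<inter> edges L = {}"
    proof (rule ccontr)
      assume "edges K \<inter> edges L \<noteq> {}"
      then obtain e where e: "e \<in> edges K" "e \<in> edges L" by blast
      then have "e \<subseteq> verts K \<inter> verts L" "e \<noteq> {}"
        using K.edge_subset L.edge_subset K.card_edge by fastforce+
      moreover have "verts K \<inter> verts L = {}" using assms(2) KL by (simp add: pairwise_def)
      ultimately show False by blast
    qed
  qed
  also have "\<dots> = (\<Sum>K\<in>S. card (edges H))"
    by (intro sum.cong) (use complete_copy_props(3) assms in auto)
  finally show ?thesis by simp
qed

definition mean_copies :: "nat \<Rightarrow> real \<Rightarrow> real" where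
  "mean_copies n p = real (card (complete_copies n)) * p ^ card (edges H)"

lemma expectation_copy_count:
  assumes "0 \<le> p" "p \<le> 1"
  shows "measure_pmf.expectation (gnp n p) (copy_count H) = mean_copies n p"
proof -
  let ?B = "bernoulli_field (all_pairs {1..n}) p"
  have fin: "finite (set_pmf ?B)"
    by (intro finite_set_bernoulli_field finite_all_pairs) simp
  have count: "copy_count H ({1..n}, {e \<in> all_pairs {1..n}. \<omega> e}) =
      (\<Sum>K\<in>complete_copies n. indicator {\<omega>. \<forall>e\<in>edges K. \<omega> e} \<omega>)" for \<omega>
    unfolding copy_count_def copies_sample
    using finite_complete_copies[of n] by (simp add: indicator_def sum.If_cases Int_def)
  have "measure_pmf.expectation (gnp n p) (copy_count H) =
      measure_pmf.expectation ?B (\<lambda>\<omega>. \<Sum>K\<in>complete_copies n. indicator {\<omega>. \<forall>e\<in>edges K. \<omega> e} \<omega>)"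
    unfolding gnp_def integral_map_pmf count ..
  also have "\<dots> = (\<Sum>K\<in>complete_copies n. measure_pmf.prob ?B {\<omega>. \<forall>e\<in>edges K. \<omega> e})"
    by (subst Bochner_Integration.integral_sum) (use integrable_measure_pmf_finite[OF fin] in blast, simp)
  also have "\<dots> = (\<Sum>K\<in>complete_copies n. p ^ card (edges H))"
  proof (intro sum.cong refl)
    fix K assume "K \<in> complete_copies n"
    then show "measure_pmf.prob ?B {\<omega>. \<forall>e\<in>edges K. \<omega> e} = p ^ card (edges H)"
      using assms complete_copy_props(3,5) finite_all_pairs[of "{1..n}"]
      by (simp add: prob_bernoulli_field_all)
  qed
  finally show ?thesis by (simp add: mean_copies_def)
qed

lemma card_complete_copies_le: "card (complete_copies n) \<le> n ^ card (verts H)"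
proof -
  have "card (complete_copies n) \<le> card (verts H \<rightarrow>\<^sub>E {1..n})"
    unfolding complete_copies_def
    by (rule surj_card_le) (use copies_subset_image[of "({1..n}, all_pairs {1..n})"] finite_verts
      in \<open>auto intro!: finite_PiE\<close>)
  then show ?thesis using finite_verts by (simp add: card_PiE)
qed

lemma copy_onto:
  assumes "U \<subseteq> {1..n}" "card U = card (verts H)"
  shows "\<exists>K\<in>complete_copies n. verts K = U"
proof -
  have "finite U" using assms(1) finite_subset by blast
  then obtain f where f: "bij_betw f (verts H) U"
    using finite_same_card_bij[OF finite_verts] assms(2) by metis
  then have inj: "inj_on f (verts H)" and im: "f ` verts H = U" by (auto simp: bij_betw_def)
  let ?K = "(U, (`) f ` edges H)"
  have pairs: "(`) f ` edges H \<subseteq> all_pairs U"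
  proof
    fix x assume "x \<in> (`) f ` edges H"
    then obtain e where e: "e \<in> edges H" "x = f ` e" by blast
    have "card x = 2"
      unfolding e using edge_subset[OF e(1)] card_edge[OF e(1)] inj by (metis card_image inj_on_subset)
    then show "x \<in> all_pairs U" using e edge_subset[OF e(1)] im by (auto simp: all_pairs_def)
  qed
  have "{u, w} \<in> edges H" if "u \<in> verts H" "w \<in> verts H" and uw: "f ` {u, w} \<in> (`) f ` edges H" for u w
  proof -
    obtain e where e: "e \<in> edges H" "f ` {u, w} = f ` e" by (rule imageE[OF uw])
    then have "{u, w} = e"
      using inj edge_subset[OF e(1)] that by (subst (asm) inj_on_image_eq_iff) auto
    then show ?thesis using e by simp
  qed
  moreover have "f ` {u, w} \<in> (`) f ` edges H" if "{u, w} \<in> edges H" for u w using that by blast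
  ultimately have "isomorphic_graphs H ?K"
    unfolding isomorphic_graphs_def using f by (intro exI[of _ f]) auto
  moreover have "subgraph ?K ({1..n}, all_pairs {1..n})"
    using pairs assms by (auto simp: subgraph_def simple_graph_def all_pairs_def)
  ultimately show ?thesis
    unfolding complete_copies_def copies_def by (intro bexI[of _ ?K]) auto
qed

text \<open>One copy on each vertex set of the right size suffices: only the order of this number
  matters, since the mean itself is carried along exactly.\<close>

lemma card_complete_copies_ge:
  assumes "card (verts H) \<le> n"
  shows "real (card (complete_copies n)) \<ge> (real n / real (card (verts H))) ^ card (verts H)"
proof -
  have "{U. U \<subseteq> {1..n} \<and> card U = card (verts H)} \<subseteq> verts ` complete_copies n"
    using copy_onto by blast
  then have "card {U. U \<subseteq> {1..n} \<and> card U = card (verts H)} \<le> card (complete_copies n)"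
    by (rule surj_card_le[OF finite_complete_copies])
  then have "n choose card (verts H) \<le> card (complete_copies n)" by (simp add: n_subsets)
  then show ?thesis
    using binomial_ge_n_over_k_pow_k[OF assms, where 'a = real] by linarith
qed

section \<open>Exponential moments of the number of isolated copies\<close>

definition isolated_copies :: "'b graph \<Rightarrow> 'b graph set" where
  "isolated_copies G = {K \<in> copies H G. \<forall>L\<in>copies H G. L \<noteq> K \<longrightarrow> verts K \<inter> verts L = {}}"

text \<open>Exponential moments: \<open>(1 + z)\<close> to the number of isolated copies expands into a sum over
  families of disjoint copies, in which all correlations vanish.\<close>

lemma prob_isolated_copies_ge:
  assumes p: "0 \<le> p" "p \<le> 1" and "z \<ge> 0"
  shows "measure_pmf.prob (gnp n p) {G. x \<le> real (card (isolated_copies G))} \<le>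
    exp (z * mean_copies n p) / (1 + z) powr x"
proof -
  let ?A = "all_pairs {1..n} :: nat set set" and ?C = "complete_copies n"
  let ?B = "bernoulli_field ?A p"
  let ?h = "card (edges H)"
  define I where "I \<omega> = isolated_copies ({1..n}, {e \<in> ?A. \<omega> e})" for \<omega>
  \<comment> \<open>Every set of isolated copies of the sample belongs to \<open>Q\<close>. The
    members of a family in \<open>Q\<close> have disjoint edge sets, so the probability that all are
    present is a pure power.\<close>
  define Q where "Q = {S. S \<subseteq> ?C \<and> pairwise (\<lambda>K L. verts K \<inter> verts L = {}) S}"
  have finA: "finite ?A" by (simp add: finite_all_pairs)
  have int: "integrable ?B f" for f :: "_ \<Rightarrow> real"
    by (intro integrable_measure_pmf_finite finite_set_bernoulli_field finA)
  have finQ: "finite Q" unfolding Q_def using finite_complete_copies by auto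
  have IC: "I \<omega> \<subseteq> {K \<in> ?C. \<forall>e\<in>edges K. \<omega> e}" for \<omega>
    unfolding I_def isolated_copies_def copies_sample by auto
  have finI: "finite (I \<omega>)" for \<omega>
    by (rule finite_subset[OF IC]) (simp add: finite_complete_copies)
  have pw: "(1 + z) ^ card A = (\<Sum>S\<in>Pow A. z ^ card S)" if "finite A" for A :: "nat graph set"
    using prod_add[OF that, of "\<lambda>_. z" "\<lambda>_. 1"] by (simp add: add.commute)
  have "measure_pmf.prob (gnp n p) {G. x \<le> real (card (isolated_copies G))} =
      measure_pmf.expectation ?B (indicator {\<omega>. x \<le> real (card (I \<omega>))})"
    by (simp add: prob_gnp I_def)
  also have "\<dots> \<le> measure_pmf.expectation ?B
      (\<lambda>\<omega>. (\<Sum>S\<in>Q. z ^ card S * indicator {\<omega>. \<forall>e\<in>\<Union>(edges ` S). \<omega> e} \<omega>) / (1 + z) powr x)"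
  proof (intro integral_mono int)
    fix \<omega>
    have "(1 + z) ^ card (I \<omega>) = (\<Sum>S\<in>Pow (I \<omega>). z ^ card S)" by (rule pw[OF finI])
    also have "\<dots> = (\<Sum>S\<in>Pow (I \<omega>). z ^ card S * indicator {\<omega>. \<forall>e\<in>\<Union>(edges ` S). \<omega> e} \<omega>)"
      using IC by (intro sum.cong) (auto simp: indicator_def)
    also have "\<dots> \<le> (\<Sum>S\<in>Q. z ^ card S * indicator {\<omega>. \<forall>e\<in>\<Union>(edges ` S). \<omega> e} \<omega>)"
    proof (rule sum_mono2[OF finQ])
      have "pairwise (\<lambda>K L. verts K \<inter> verts L = {}) (I \<omega>)"
        by (auto simp: I_def isolated_copies_def pairwise_def)
      then show "Pow (I \<omega>) \<subseteq> Q"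
        unfolding Q_def using IC by (auto intro: pairwise_subset)
    qed (use \<open>z \<ge> 0\<close> in auto)
    finally have *: "(1 + z) ^ card (I \<omega>) \<le> (\<Sum>S\<in>Q. z ^ card S * indicator {\<omega>. \<forall>e\<in>\<Union>(edges ` S). \<omega> e} \<omega>)" .
    show "indicator {\<omega>. x \<le> real (card (I \<omega>))} \<omega> \<le>
      (\<Sum>S\<in>Q. z ^ card S * indicator {\<omega>. \<forall>e\<in>\<Union>(edges ` S). \<omega> e} \<omega>) / (1 + z) powr x"
    proof (cases "x \<le> real (card (I \<omega>))")
      case True
      have "(1 + z) powr x \<le> (1 + z) powr real (card (I \<omega>))"
        using True \<open>z \<ge> 0\<close> by (intro powr_mono) auto
      also have "\<dots> = (1 + z) ^ card (I \<omega>)" using \<open>z \<ge> 0\<close> by (simp add: powr_realpow)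
      also note *
      finally show ?thesis using True \<open>z \<ge> 0\<close> by simp
    next
      case False
      then show ?thesis using \<open>z \<ge> 0\<close> by (auto intro!: divide_nonneg_nonneg sum_nonneg)
    qed
  qed
  also have "\<dots> = (\<Sum>S\<in>Q. z ^ card S * measure_pmf.prob ?B {\<omega>. \<forall>e\<in>\<Union>(edges ` S). \<omega> e}) / (1 + z) powr x"
    unfolding integral_divide_zero
    by (subst Bochner_Integration.integral_sum, use int in blast) simp
  also have "(\<Sum>S\<in>Q. z ^ card S * measure_pmf.prob ?B {\<omega>. \<forall>e\<in>\<Union>(edges ` S). \<omega> e}) =
      (\<Sum>S\<in>Q. (z * p ^ ?h) ^ card S)"
  proof (intro sum.cong refl)
    fix S assume S: "S \<in> Q"
    then have "measure_pmf.prob ?B {\<omega>. \<forall>e\<in>\<Union>(edges ` S). \<omega> e} = p ^ card (\<Union>(edges ` S))"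
      using Union_edges_complete_copies p finA unfolding Q_def by (intro prob_bernoulli_field_all) auto
    also have "\<dots> = (p ^ ?h) ^ card S"
      using S card_Union_edges_disjoint[of S n] by (simp add: Q_def power_mult)
    finally show "z ^ card S * measure_pmf.prob ?B {\<omega>. \<forall>e\<in>\<Union>(edges ` S). \<omega> e} = (z * p ^ ?h) ^ card S"
      by (simp add: power_mult_distrib)
  qed
  \<comment> \<open>Once the probabilities are evaluated, disjointness is dropped; the sum over all
    families is the generating function of a binomial variable.\<close>
  also have "\<dots> \<le> (\<Sum>S\<in>Pow ?C. (z * p ^ ?h) ^ card S)"
    by (rule sum_mono2) (use finite_complete_copies assms in \<open>auto simp: Q_def\<close>)
  also have "\<dots> = (1 + z * p ^ ?h) ^ card ?C"
    using prod_add[OF finite_complete_copies, of "\<lambda>_. z * p ^ ?h" "\<lambda>_. 1" n] by (simp add: add.commute)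
  also have "\<dots> \<le> exp (z * p ^ ?h) ^ card ?C"
    using assms by (intro power_mono) auto
  also have "\<dots> = exp (z * mean_copies n p)"
    by (simp add: mean_copies_def exp_of_nat_mult[symmetric] algebra_simps)
  finally show ?thesis by (simp add: divide_right_mono)
qed

section \<open>Union bound over clusters of overlapping copies\<close>

text \<open>Here \<open>u\<close> and \<open>e\<close> count the vertices and edges of a union of overlapping copies.\<close>

definition cluster_sizes :: "nat \<Rightarrow> (nat \<times> nat) set" where
  "cluster_sizes s = {(u, e). u \<le> 4 * s * card (edges H) \<and> e \<le> 2 * s * card (edges H) \<and>
     s ^ 2 \<le> (2 * e) ^ card (verts H) \<and>
     2 * e + (1 + \<Delta>) ^ (card (verts H) + 1) * (\<Delta> * u) \<le> (1 + \<Delta>) ^ (card (verts H) + 1) * (2 * e)}"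

lemma finite_cluster_sizes: "finite (cluster_sizes s)"
  unfolding cluster_sizes_def
  by (rule finite_subset[of _ "{..4 * s * card (edges H)} \<times> {..2 * s * card (edges H)}"]) auto

lemma card_cluster_sizes_le:
  "card (cluster_sizes s) \<le> (4 * s * card (edges H) + 1) * (2 * s * card (edges H) + 1)"
proof -
  have "card (cluster_sizes s) \<le> card ({..4 * s * card (edges H)} \<times> {..2 * s * card (edges H)})"
    unfolding cluster_sizes_def by (rule card_mono) auto
  then show ?thesis by simp
qed

text \<open>Only \<open>s\<close> copies with one partner each are taken, rather than all
  overlapping ones. This keeps both sizes of order at most \<open>s\<close>, so that the number of
  possible sizes and the later factors \<open>u ^ 2\<close> stay harmless.\<close>

lemma cluster_of_overlapping_copies:
  assumes "finite (copies H G)" "s \<le> card (copies H G - isolated_copies G)"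
  shows "\<exists>F\<subseteq>edges G. (\<forall>e\<in>F. card e = 2) \<and> (card (\<Union>F), card F) \<in> cluster_sizes s"
proof -
  let ?h = "card (edges H)" and ?v = "card (verts H)"
  obtain S where S: "S \<subseteq> copies H G - isolated_copies G" "card S = s" "finite S"
    using assms by (metis obtain_subset_with_card_n)
  have "\<forall>K\<in>S. \<exists>L. L \<in> copies H G \<and> L \<noteq> K \<and> verts K \<inter> verts L \<noteq> {}"
    using S(1) unfolding isolated_copies_def by blast
  then obtain g where g: "\<And>K. K \<in> S \<Longrightarrow> g K \<in> copies H G \<and> g K \<noteq> K \<and> verts K \<inter> verts (g K) \<noteq> {}"
    by metis
  define \<K> where "\<K> = S \<union> g ` S"
  have sub: "\<K> \<subseteq> copies H G" using S g by (auto simp: \<K>_def)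
  have finK: "finite \<K>" using S by (simp add: \<K>_def)
  define F where "F = \<Union>(edges ` \<K>)"
  have reg: "connected_regular_graph K \<Delta>" "card (verts K) = ?v" "card (edges K) = ?h" if "K \<in> \<K>" for K
    using copy_props sub that by blast+
  have cF: "card e = 2" if "e \<in> F" for e
    using that connected_regular_graph.card_edge[OF reg(1)] by (auto simp: F_def)
  have finF: "finite F"
    unfolding F_def using finK connected_regular_graph.finite_edges[OF reg(1)] by blast
  have finE: "finite e" if "e \<in> F" for e using cF[OF that] by (intro card_ge_0_finite) simp
  have ex: "2 * card F + (1 + \<Delta>) ^ (?v + 1) * (\<Delta> * card (\<Union>F)) \<le> (1 + \<Delta>) ^ (?v + 1) * (2 * card F)"
  proof (rule overlapping_copies_excess[OF finK reg _ F_def])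
    fix K assume "K \<in> \<K>"
    then consider "K \<in> S" | L where "L \<in> S" "K = g L" by (auto simp: \<K>_def)
    then show "\<exists>L\<in>\<K>. L \<noteq> K \<and> verts K \<inter> verts L \<noteq> {}"
    proof cases
      case 1
      then show ?thesis using g by (intro bexI[of _ "g K"]) (auto simp: \<K>_def)
    next
      case 2
      then have "L \<noteq> K" "verts K \<inter> verts L \<noteq> {}" using g[OF 2(1)] by (auto simp: Int_commute)
      then show ?thesis using 2 by (intro bexI[of _ L]) (auto simp: \<K>_def)
    qed
  qed
  have "card F \<le> (\<Sum>K\<in>\<K>. card (edges K))" unfolding F_def by (rule card_UN_le[OF finK])
  also have "\<dots> = card \<K> * ?h" using reg(3) by simp
  also have "card \<K> \<le> 2 * s"
    unfolding \<K>_def using S card_image_le[of S g] card_Un_le[of S "g ` S"] by linarith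
  finally have eb: "card F \<le> 2 * s * ?h" by simp
  have "card (\<Union>F) \<le> sum card F" by (rule card_Union_le_sum_card)
  also have "\<dots> = 2 * card F" using cF by simp
  finally have ub: "card (\<Union>F) \<le> 4 * s * ?h" using eb by simp
  have simpF: "simple_graph (\<Union>F, F)" using cF by (auto simp: simple_graph_def all_pairs_def)
  have "\<K> \<subseteq> copies H (\<Union>F, F)"
  proof
    fix K assume K: "K \<in> \<K>"
    then have "edges K \<subseteq> F" by (auto simp: F_def)
    moreover from this have "verts K \<subseteq> \<Union>F"
      using connected_regular_graph.Union_edges[OF reg(1)[OF K]] by blast
    ultimately show "K \<in> copies H (\<Union>F, F)"
      using sub K by (auto simp: copies_def subgraph_def)
  qed
  then have "s \<le> card (copies H (\<Union>F, F))"
    using finF finE S card_mono[OF finite_copies[of "(\<Union>F, F)"]] by (fastforce simp: \<K>_def)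
  then have "s ^ 2 \<le> card (copies H (\<Union>F, F)) ^ 2" by (intro power_mono) auto
  also have "\<dots> \<le> (2 * card F) ^ ?v"
    using card_copies_le[OF _ simpF] finF finE by simp
  finally have "(card (\<Union>F), card F) \<in> cluster_sizes s"
    using ex eb ub by (simp add: cluster_sizes_def)
  moreover have "F \<subseteq> edges G" using sub copy_props(5) unfolding F_def by blast
  ultimately show ?thesis using cF by blast
qed

text \<open>Vertices are chosen before edges: \<open>u\<close> vertices cost n^u, after which each
  edge costs only \<open>u ^ 2\<close>, polylogarithmic in the application. Choosing edges directly
  among all pairs would cost about n^2 each.\<close>

lemma prob_overlapping_copies_ge:
  assumes p: "0 \<le> p" "p \<le> 1"
  shows "measure_pmf.prob (gnp n p) {G. s \<le> card (copies H G - isolated_copies G)} \<le>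
    (\<Sum>(u, e)\<in>cluster_sizes s. real n ^ u * (real u ^ 2) ^ e * p ^ e)"
proof -
  let ?A = "all_pairs {1..n} :: nat set set"
  let ?B = "bernoulli_field ?A p"
  have finA: "finite ?A" by (simp add: finite_all_pairs)
  define Q where "Q = {F. F \<subseteq> ?A \<and> (card (\<Union>F), card F) \<in> cluster_sizes s}"
  have finQ: "finite Q" using finA by (simp add: Q_def)
  have "measure_pmf.prob (gnp n p) {G. s \<le> card (copies H G - isolated_copies G)} \<le>
      measure_pmf.prob ?B {\<omega>. \<exists>F\<in>Q. \<forall>e\<in>F. \<omega> e}"
    unfolding prob_gnp
  proof (rule measure_pmf.finite_measure_mono, rule subsetI)
    fix \<omega> :: "nat set \<Rightarrow> bool"
    let ?G = "({1..n}, {e \<in> ?A. \<omega> e})"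
    assume "\<omega> \<in> {\<omega>. ({1..n}, {e \<in> ?A. \<omega> e}) \<in> {G. s \<le> card (copies H G - isolated_copies G)}}"
    then have "\<exists>F\<subseteq>edges ?G. (\<forall>e\<in>F. card e = 2) \<and> (card (\<Union>F), card F) \<in> cluster_sizes s"
      by (intro cluster_of_overlapping_copies finite_copies) auto
    then show "\<omega> \<in> {\<omega>. \<exists>F\<in>Q. \<forall>e\<in>F. \<omega> e}" by (auto simp: Q_def)
  qed simp
  also have "\<dots> \<le> (\<Sum>F\<in>Q. p ^ card F)"
    by (rule prob_bernoulli_field_family_le[OF finA p finQ]) (simp add: Q_def)
  also have "\<dots> = (\<Sum>ue\<in>cluster_sizes s. \<Sum>F\<in>{F. F \<in> Q \<and> (card (\<Union>F), card F) = ue}. p ^ card F)"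
    by (rule sum.group[symmetric, OF finQ finite_cluster_sizes]) (auto simp: Q_def)
  also have "\<dots> \<le> (\<Sum>(u, e)\<in>cluster_sizes s. real n ^ u * (real u ^ 2) ^ e * p ^ e)"
  proof (intro sum_mono, clarify)
    fix u e
    let ?R = "{F. F \<in> Q \<and> (card (\<Union>F), card F) = (u, e)}"
    let ?U = "{U. U \<subseteq> {1..n} \<and> card U = u}"
    have finR: "finite {F. F \<subseteq> all_pairs U \<and> card F = e}" if "U \<in> ?U" for U
      using that finite_all_pairs[of U] finite_subset[of U "{1..n}"] by simp
    have "card ?R \<le> card (Sigma ?U (\<lambda>U. {F. F \<subseteq> all_pairs U \<and> card F = e}))"
    proof (rule card_inj_on_le[of "\<lambda>F. (\<Union>F, F)"])
      show "finite (Sigma ?U (\<lambda>U. {F. F \<subseteq> all_pairs U \<and> card F = e}))"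
        by (intro finite_SigmaI finR) auto
    qed (auto simp: inj_on_def Q_def all_pairs_def)
    also have "\<dots> = (\<Sum>U\<in>?U. card {F. F \<subseteq> all_pairs U \<and> card F = e})"
      by (intro card_SigmaI ballI finR) auto
    also have "\<dots> = (\<Sum>U\<in>?U. (u choose 2) choose e)"
    proof (intro sum.cong refl)
      fix U assume "U \<in> ?U"
      then have "finite U" "card U = u" by (auto intro: finite_subset)
      then show "card {F. F \<subseteq> all_pairs U \<and> card F = e} = (u choose 2) choose e"
        by (simp add: n_subsets finite_all_pairs card_all_pairs)
    qed
    also have "\<dots> = (n choose u) * ((u choose 2) choose e)"
      by (simp add: n_subsets)
    also have "\<dots> \<le> n ^ u * (u ^ 2) ^ e"
      by (intro mult_le_mono binomial_le_power order_trans[OF binomial_le_power power_mono]) auto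
    finally have "real (card ?R) \<le> real (n ^ u * (u ^ 2) ^ e)" by (rule of_nat_mono)
    then show "(\<Sum>F\<in>?R. p ^ card F) \<le> real n ^ u * (real u ^ 2) ^ e * p ^ e"
      using p by (simp add: mult_right_mono)
  qed
  finally show ?thesis .
qed

end

section \<open>Lower bound for the upper tail\<close>

text \<open>The constant \<open>1 / (1 - p)\<close> is uniform in \<open>x\<close>. In the
  application \<open>x\<close> is \<open>p\<close> to the number of missing edges, hence at most
  \<open>p\<close>, and the constant tends to 1.\<close>

lemma one_minus_ge_exp:
  fixes x p :: real
  assumes "0 \<le> x" "x \<le> p" "p < 1"
  shows "exp (- (x / (1 - p))) \<le> 1 - x"
proof -
  have "1 \<le> (1 + x / (1 - x)) * (1 - x)" using assms by (simp add: field_simps)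
  also have "\<dots> \<le> exp (x / (1 - x)) * (1 - x)"
    using assms exp_ge_add_one_self[of "x / (1 - x)"] by (intro mult_right_mono) auto
  also have "\<dots> \<le> exp (x / (1 - p)) * (1 - x)"
    using assms by (intro mult_right_mono) (auto intro!: divide_left_mono mult_pos_pos)
  finally show ?thesis by (simp add: exp_minus field_simps)
qed

context connected_regular_graph
begin

text \<open>If all degrees in \<open>J\<close> were \<open>\<Delta>\<close>, no edge could leave
  \<open>\<Union>J\<close> and connectivity would give \<open>J = edges H\<close>. So some degree is
  smaller; this unit of deficiency later yields a factor n^(-1/\<Delta>).\<close>

lemma proper_edge_subset_deficient:
  assumes "J \<subseteq> edges H" "J \<noteq> {}" "J \<noteq> edges H"
  shows "2 * card J + 1 \<le> \<Delta> * card (\<Union>J)"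
proof -
  let ?U = "\<Union>J"
  have finJ: "finite J" using assms finite_edges finite_subset by blast
  have U: "?U \<subseteq> verts H" using assms edge_subset by blast
  have finU: "finite ?U" using U finite_verts finite_subset by blast
  have sub: "{e \<in> J. w \<in> e} \<subseteq> {e \<in> edges H. w \<in> e}" for w using assms by blast
  have le: "degree_in J w \<le> \<Delta>" if "w \<in> ?U" for w
    using card_mono[OF _ sub[of w]] degree_in_edges[of w] finite_edges U that
    unfolding degree_in_def by auto
  have sum: "(\<Sum>w\<in>?U. degree_in J w) = 2 * card J"
    by (rule sum_degree_in) (use assms card_edge finJ finU in auto)
  have "\<exists>w\<in>?U. degree_in J w < \<Delta>"
  proof (rule ccontr)
    assume "\<not> ?thesis"
    then have eq: "degree_in J w = \<Delta>" if "w \<in> ?U" for w using le that by force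
    have absorb: "e \<in> J" if "e \<in> edges H" "w \<in> e" "w \<in> ?U" for e w
    proof -
      have "{e \<in> J. w \<in> e} = {e \<in> edges H. w \<in> e}"
        using eq[OF that(3)] degree_in_edges[of w] U that finite_edges sub
        unfolding degree_in_def by (intro card_subset_eq) auto
      then show ?thesis using that by blast
    qed
    obtain e where e: "e \<in> J" using assms by blast
    then have "e \<noteq> {}" using card_edge assms by fastforce
    then obtain a where a: "a \<in> ?U" using e by blast
    have "verts H \<subseteq> ?U"
    proof
      fix b assume b: "b \<in> verts H"
      show "b \<in> ?U"
      proof (rule ccontr)
        assume "b \<notin> ?U"
        then obtain x y where "{x, y} \<in> edges H" "x \<in> ?U" "y \<notin> ?U"
          using connected_graph_cut[OF connected _ a b] U a by blast
        then show False using absorb[of "{x, y}" x] by blast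
      qed
    qed
    have "edges H \<subseteq> J"
    proof
      fix e assume e: "e \<in> edges H"
      then have "e \<noteq> {}" using card_edge by fastforce
      then obtain w where "w \<in> e" by blast
      then show "e \<in> J" using absorb[OF e] edge_subset[OF e] \<open>verts H \<subseteq> ?U\<close> by blast
    qed
    then show False using assms by blast
  qed
  then have "(\<Sum>w\<in>?U. degree_in J w) < (\<Sum>w\<in>?U. \<Delta>)"
    using finU le by (intro sum_strict_mono_ex1) auto
  then show ?thesis using sum by (simp add: mult.commute)
qed

text \<open>The union of disjoint copies has degree \<open>\<Delta>\<close> at each of its vertices,
  so rigidity applies. Hence planting \<open>S\<close> never creates a further copy, and every other
  copy lacks at least one edge.\<close>

lemma copy_not_within_disjoint_copies:
  assumes "S \<subseteq> complete_copies n" "pairwise (\<lambda>K L. verts K \<inter> verts L = {}) S"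
    and "K \<in> complete_copies n" "K \<notin> S"
  shows "\<not> edges K \<subseteq> \<Union>(edges ` S)"
proof
  assume sub: "edges K \<subseteq> \<Union>(edges ` S)"
  let ?F = "\<Union>(edges ` S)"
  interpret K: connected_regular_graph K \<Delta> using complete_copy_props(1)[OF assms(3)] .
  have finF: "finite ?F"
    using Union_edges_complete_copies[OF assms(1)] finite_all_pairs[of "{1..n}"] finite_subset by blast
  have "edges K \<noteq> {}" using K.edges_nonempty by auto
  then obtain e where "e \<in> edges K" by blast
  then obtain L where L: "L \<in> S" "e \<in> edges L" using sub by blast
  interpret L: connected_regular_graph L \<Delta> using complete_copy_props(1) assms(1) L(1) by blast
  have "e \<noteq> {}" using L.card_edge[OF L(2)] by auto
  then have meet: "verts L \<inter> verts K \<noteq> {}"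
    using L.edge_subset[OF L(2)] K.edge_subset[OF \<open>e \<in> edges K\<close>] by blast
  have sat: "degree_in ?F w = \<Delta>" if w: "w \<in> verts L" for w
  proof -
    have "e \<in> edges L" if e: "e \<in> edges L'" "L' \<in> S" "w \<in> e" for e L'
    proof (cases "L' = L")
      case False
      then have "verts L' \<inter> verts L = {}" using assms(2) L(1) e(2) by (simp add: pairwise_def)
      moreover have "e \<subseteq> verts L'"
        using connected_regular_graph.edge_subset[OF complete_copy_props(1)] assms(1) e by blast
      ultimately show ?thesis using w e(3) by blast
    qed (use e in simp)
    then have "{e \<in> ?F. w \<in> e} = {e \<in> edges L. w \<in> e}" using L(1) by blast
    then show ?thesis using L.degree_in_edges[OF w] by (simp add: degree_in_def)
  qed
  have "L = K"
    using saturated_copy_unique[OF L.connected_regular_graph_axioms K.connected_regular_graph_axioms finF _ sub _ sat meet]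
      L(1) complete_copy_props(3)[OF assms(3)] complete_copy_props(3)[of L n] assms(1) by auto
  then show False using L(1) assms(4) by simp
qed

text \<open>\<open>J\<close> is the set of edges that an embedding sends into a family of
  \<open>k\<close> copies: its vertices have at most \<open>k\<close> times
  \<open>card (verts H)\<close> possible images, the others at most \<open>n\<close>, and each edge
  outside \<open>J\<close> costs a factor \<open>p\<close>. The empty set gives the main term and
  the full set is impossible, so both are left out.\<close>

definition overlap_error :: "nat \<Rightarrow> nat \<Rightarrow> real \<Rightarrow> real" where
  "overlap_error n k p = (\<Sum>J\<in>Pow (edges H) - {{}, edges H}.
     real (k * card (verts H)) ^ card (\<Union>J) * real n ^ (card (verts H) - card (\<Union>J))
       * p ^ (card (edges H) - card J))"

lemma sum_missing_edges_le:
  assumes p: "0 \<le> p" "p \<le> 1"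
    and S: "S \<subseteq> complete_copies n" "pairwise (\<lambda>K L. verts K \<inter> verts L = {}) S"
  shows "(\<Sum>K\<in>complete_copies n - S. p ^ card (edges K - \<Union>(edges ` S))) \<le>
    mean_copies n p + overlap_error n (card S) p"
proof -
  let ?V = "verts H" and ?E = "edges H"
  let ?F = "\<Union>(edges ` S)" and ?W = "\<Union>(verts ` S)" and ?C = "complete_copies n - S"
  have finS: "finite S" using S finite_complete_copies finite_subset by blast
  have finC: "finite ?C" using finite_complete_copies by simp
  have "\<exists>f. f \<in> ?V \<rightarrow>\<^sub>E {1..n} \<and> inj_on f ?V \<and> K = (f ` ?V, (`) f ` ?E)" if "K \<in> ?C" for K
  proof -
    have "K \<in> copies H ({1..n}, all_pairs {1..n})" using that by (simp add: complete_copies_def)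
    from subsetD[OF copies_subset_image this] show ?thesis by auto
  qed
  \<comment> \<open>One embedding is fixed for each copy. It determines the copy, so counting these
    embeddings loses nothing.\<close>
  then obtain f where f: "\<And>K. K \<in> ?C \<Longrightarrow> f K \<in> ?V \<rightarrow>\<^sub>E {1..n} \<and> inj_on (f K) ?V \<and> K = (f K ` ?V, (`) (f K) ` ?E)"
    by metis
  define J where "J K = {e \<in> ?E. f K ` e \<in> ?F}" for K
  have JE: "J K \<subseteq> ?E" for K by (auto simp: J_def)
  have edgesK: "edges K = (`) (f K) ` ?E" if "K \<in> ?C" for K using f[OF that] by (metis snd_conv)
  have inj2: "inj_on ((`) (f K)) ?E" if "K \<in> ?C" for K
    by (rule inj_on_subset[OF inj_on_image_Pow]) (use f[OF that] edge_subset in auto)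
  have card_missing: "card (edges K - ?F) = card ?E - card (J K)" if K: "K \<in> ?C" for K
  proof -
    have "edges K - ?F = (`) (f K) ` (?E - J K)" unfolding edgesK[OF K] J_def by blast
    then have "card (edges K - ?F) = card (?E - J K)"
      using card_image[OF inj_on_subset[OF inj2[OF K]], of "?E - J K"] by simp
    then show ?thesis using card_Diff_subset[OF finite_subset[OF JE finite_edges] JE] by simp
  qed
  have Jproper: "J K \<noteq> ?E" if K: "K \<in> ?C" for K
  proof
    assume "J K = ?E"
    then have "edges K \<subseteq> ?F" unfolding edgesK[OF K] by (auto simp: J_def)
    then show False using copy_not_within_disjoint_copies[OF S, of K] K by blast
  qed
  have finP: "finite (Pow ?E - {?E})" using finite_edges by simp
  have "(\<Sum>K\<in>?C. p ^ card (edges K - ?F)) = (\<Sum>K\<in>?C. p ^ (card ?E - card (J K)))"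
    by (intro sum.cong) (auto simp: card_missing)
  also have "\<dots> = (\<Sum>I\<in>Pow ?E - {?E}. \<Sum>K\<in>{K. K \<in> ?C \<and> J K = I}. p ^ (card ?E - card (J K)))"
    by (rule sum.group[symmetric, OF finC finP]) (use JE Jproper in auto)
  also have "\<dots> = (\<Sum>I\<in>Pow ?E - {?E}. real (card {K. K \<in> ?C \<and> J K = I}) * p ^ (card ?E - card I))"
    by (intro sum.cong refl) simp
  also have "Pow ?E - {?E} = insert {} (Pow ?E - {{}, ?E})" using edges_nonempty by auto
  also have "(\<Sum>I\<in>insert {} (Pow ?E - {{}, ?E}). real (card {K. K \<in> ?C \<and> J K = I}) * p ^ (card ?E - card I)) =
      real (card {K. K \<in> ?C \<and> J K = {}}) * p ^ card ?E +
      (\<Sum>I\<in>Pow ?E - {{}, ?E}. real (card {K. K \<in> ?C \<and> J K = I}) * p ^ (card ?E - card I))"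
    using finite_edges by (subst sum.insert) auto
  also have "\<dots> \<le> mean_copies n p + overlap_error n (card S) p"
  proof (rule add_mono)
    have "card {K. K \<in> ?C \<and> J K = {}} \<le> card (complete_copies n)"
      by (rule card_mono[OF finite_complete_copies]) auto
    then show "real (card {K. K \<in> ?C \<and> J K = {}}) * p ^ card ?E \<le> mean_copies n p"
      unfolding mean_copies_def using p by (intro mult_right_mono) auto
    show "(\<Sum>I\<in>Pow ?E - {{}, ?E}. real (card {K. K \<in> ?C \<and> J K = I}) * p ^ (card ?E - card I))
        \<le> overlap_error n (card S) p"
      unfolding overlap_error_def
    proof (intro sum_mono mult_right_mono)
      fix I assume I: "I \<in> Pow ?E - {{}, ?E}"
      have UI: "\<Union>I \<subseteq> ?V" using I edge_subset by blast
      have finW: "finite ?W"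
        using finS connected_regular_graph.finite_verts[OF complete_copy_props(1)] S(1) by blast
      have "card ?W \<le> (\<Sum>K\<in>S. card (verts K))" by (rule card_UN_le[OF finS])
      also have "\<dots> = (\<Sum>K\<in>S. card ?V)"
        by (intro sum.cong) (use complete_copy_props(2) S in auto)
      finally have cW: "card ?W \<le> card S * card ?V" by simp
      \<comment> \<open>Vertices lying on edges of \<open>I\<close> have to land on vertices of the
        family; the remaining ones are unrestricted.\<close>
      let ?P = "PiE ?V (\<lambda>w. if w \<in> \<Union>I then ?W else {1..n})"
      have finPi: "finite ?P" using finite_verts finW by (intro finite_PiE) auto
      have "f ` {K. K \<in> ?C \<and> J K = I} \<subseteq> ?P"
      proof (clarify)
        fix a b assume K: "(a, b) \<in> complete_copies n" "(a, b) \<notin> S" "I = J (a, b)"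
        then have C: "(a, b) \<in> ?C" by simp
        note fK = f[OF C]
        have "f (a, b) w \<in> ?W" if w: "w \<in> \<Union>(J (a, b))" for w
        proof -
          obtain e where e: "e \<in> ?E" "f (a, b) ` e \<in> ?F" "w \<in> e" using w by (auto simp: J_def)
          then obtain L where L: "L \<in> S" "f (a, b) ` e \<in> edges L" by blast
          then have "f (a, b) ` e \<subseteq> verts L"
            using connected_regular_graph.edge_subset[OF complete_copy_props(1)] S(1) by blast
          then show ?thesis using L e by blast
        qed
        then show "f (a, b) \<in> PiE ?V (\<lambda>w. if w \<in> \<Union>(J (a, b)) then ?W else {1..n})"
          using fK by (auto simp: PiE_iff)
      qed
      moreover have "inj_on f {K. K \<in> ?C \<and> J K = I}"
      proof (rule inj_onI)
        fix K L assume "K \<in> {K. K \<in> ?C \<and> J K = I}" "L \<in> {K. K \<in> ?C \<and> J K = I}" "f K = f L"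
        then show "K = L" using f[of K] f[of L] by auto
      qed
      ultimately have "card {K. K \<in> ?C \<and> J K = I} \<le> card ?P"
        using card_inj_on_le finPi by blast
      also have "card ?P = card ?W ^ card (\<Union>I) * n ^ (card ?V - card (\<Union>I))"
      proof -
        have "card ?P = (\<Prod>w\<in>?V. if w \<in> \<Union>I then card ?W else n)"
          using finite_verts by (subst card_PiE) (auto intro!: prod.cong)
        also have "\<dots> = card ?W ^ card (?V \<inter> \<Union>I) * n ^ card (?V \<inter> - \<Union>I)"
          unfolding prod.If_cases[OF finite_verts] prod_constant Collect_mem_eq ..
        also have "?V \<inter> \<Union>I = \<Union>I" using UI by blast
        also have "card (?V \<inter> - \<Union>I) = card ?V - card (\<Union>I)"
          using UI finite_verts by (metis Diff_eq card_Diff_subset finite_subset)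
        finally show ?thesis .
      qed
      also have "\<dots> \<le> (card S * card ?V) ^ card (\<Union>I) * n ^ (card ?V - card (\<Union>I))"
        using cW by (intro mult_right_mono power_mono) auto
      finally show "real (card {K. K \<in> ?C \<and> J K = I}) \<le>
          real (card S * card ?V) ^ card (\<Union>I) * real n ^ (card ?V - card (\<Union>I))"
        by (simp flip: of_nat_power of_nat_mult add: of_nat_le_iff)
    qed (use p in auto)
  qed
  finally show ?thesis .
qed

section \<open>Probability and number of planted disjoint families\<close>

definition disjoint_families :: "nat \<Rightarrow> nat \<Rightarrow> nat graph set set" where
  "disjoint_families n k =
     {S. S \<subseteq> complete_copies n \<and> card S = k \<and> pairwise (\<lambda>K L. verts K \<inter> verts L = {}) S}"

lemma finite_disjoint_families: "finite (disjoint_families n k)"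
  unfolding disjoint_families_def using finite_complete_copies by simp

text \<open>Asking for exactly the copies in \<open>S\<close> makes the events for different
  \<open>S\<close> mutually exclusive, so their probabilities can be added without
  correction.\<close>

lemma prob_copies_eq_ge:
  assumes p: "0 \<le> p" "p < 1" and S: "S \<in> disjoint_families n k"
  shows "measure_pmf.prob (gnp n p) {G. copies H G = S} \<ge>
    p ^ (card (edges H) * k) * exp (- ((mean_copies n p + overlap_error n k p) / (1 - p)))"
proof -
  let ?A = "all_pairs {1..n} :: nat set set"
  let ?B = "bernoulli_field ?A p"
  let ?F = "\<Union>(edges ` S)" and ?C = "complete_copies n - S"
  have S': "S \<subseteq> complete_copies n" "pairwise (\<lambda>K L. verts K \<inter> verts L = {}) S" "card S = k"
    using S by (auto simp: disjoint_families_def)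
  have finA: "finite ?A" by (simp add: finite_all_pairs)
  have FA: "?F \<subseteq> ?A" by (rule Union_edges_complete_copies[OF S'(1)])
  \<comment> \<open>The missing edge is sought outside the planted edges, which makes
    \<open>D\<close> independent of them.\<close>
  define D where "D = {\<omega>. \<forall>K\<in>?C. \<exists>e\<in>edges K - ?F. \<not> \<omega> e}"
  have "{\<omega>. copies H ({1..n}, {e \<in> ?A. \<omega> e}) = S} = {\<omega> \<in> D. \<forall>e\<in>?F. \<omega> e}"
  proof (intro equalityI subsetI)
    fix \<omega> assume "\<omega> \<in> {\<omega>. copies H ({1..n}, {e \<in> ?A. \<omega> e}) = S}"
    then have eq: "{K \<in> complete_copies n. \<forall>e\<in>edges K. \<omega> e} = S" unfolding copies_sample by simp
    have 1: "\<forall>e\<in>?F. \<omega> e" using eq by blast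
    have "\<exists>e\<in>edges K - ?F. \<not> \<omega> e" if "K \<in> ?C" for K
    proof -
      have "\<not> (\<forall>e\<in>edges K. \<omega> e)" using eq that by blast
      then show ?thesis using 1 by blast
    qed
    with 1 show "\<omega> \<in> {\<omega> \<in> D. \<forall>e\<in>?F. \<omega> e}" unfolding D_def by blast
  next
    fix \<omega> assume "\<omega> \<in> {\<omega> \<in> D. \<forall>e\<in>?F. \<omega> e}"
    then have "{K \<in> complete_copies n. \<forall>e\<in>edges K. \<omega> e} = S"
      using S'(1) unfolding D_def by blast
    then show "\<omega> \<in> {\<omega>. copies H ({1..n}, {e \<in> ?A. \<omega> e}) = S}" unfolding copies_sample by simp
  qed
  then have "measure_pmf.prob (gnp n p) {G. copies H G = S} =
      measure_pmf.prob ?B {\<omega> \<in> D. \<forall>e\<in>?F. \<omega> e}"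
    by (simp only: prob_gnp mem_Collect_eq)
  also have "\<dots> = p ^ card ?F * measure_pmf.prob ?B D"
  proof (rule prob_bernoulli_field_all_indep[OF finA FA])
    fix f g :: "nat set \<Rightarrow> bool" assume *: "\<And>x. x \<notin> ?F \<Longrightarrow> f x = g x"
    then have "(\<exists>e\<in>edges K - ?F. \<not> f e) \<longleftrightarrow> (\<exists>e\<in>edges K - ?F. \<not> g e)" for K by blast
    then show "f \<in> D \<longleftrightarrow> g \<in> D" unfolding D_def mem_Collect_eq by presburger
  qed (use p in auto)
  also have "card ?F = card (edges H) * k" using card_Union_edges_disjoint[OF S'(1,2)] S'(3) by simp
  finally have eq: "measure_pmf.prob (gnp n p) {G. copies H G = S} =
      p ^ (card (edges H) * k) * measure_pmf.prob ?B D" .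
  have "exp (- ((mean_copies n p + overlap_error n k p) / (1 - p))) \<le>
      exp (- ((\<Sum>K\<in>?C. p ^ card (edges K - ?F)) / (1 - p)))"
    using sum_missing_edges_le[OF _ _ S'(1,2), of p] S'(3) p by (auto intro!: divide_right_mono)
  also have "\<dots> = (\<Prod>K\<in>?C. exp (- (p ^ card (edges K - ?F) / (1 - p))))"
    using finite_complete_copies[of n] by (simp add: exp_sum[symmetric] sum_divide_distrib sum_negf)
  also have "\<dots> \<le> (\<Prod>K\<in>?C. 1 - p ^ card (edges K - ?F))"
  proof (intro prod_mono conjI one_minus_ge_exp)
    fix K assume K: "K \<in> ?C"
    then have "edges K - ?F \<noteq> {}" using copy_not_within_disjoint_copies[OF S'(1,2)] by blast
    moreover have "finite (edges K)"
      using K connected_regular_graph.finite_edges[OF complete_copy_props(1)] by blast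
    ultimately have "card (edges K - ?F) \<ge> 1"
      by (metis One_nat_def Suc_leI card_gt_0_iff finite_Diff)
    then show "p ^ card (edges K - ?F) \<le> p"
      using p power_decreasing[of 1 "card (edges K - ?F)" p] by simp
  qed (use p in auto)
  also have "\<dots> \<le> measure_pmf.prob ?B D"
    unfolding D_def
  proof (rule prob_bernoulli_field_none_contained[OF finA])
    show "finite ?C" using finite_complete_copies by simp
    show "edges K - ?F \<subseteq> ?A" if "K \<in> ?C" for K
      using that complete_copy_props(5) by blast
  qed (use p in auto)
  finally show ?thesis unfolding eq using p by (simp add: mult_left_mono)
qed

text \<open>Double counting: a family of size \<open>k\<close> with a copy disjoint from it, against
  a family of size \<open>k + 1\<close> with a marked member. The subtracted term bounds the copies
  that meet the family: choose a vertex of \<open>H\<close>, its image in the family, and free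
  images for the rest.\<close>

lemma card_disjoint_families_Suc:
  "real (card (disjoint_families n (Suc k))) * real (Suc k) \<ge> real (card (disjoint_families n k)) *
    (real (card (complete_copies n)) - real (card (verts H)) ^ 2 * real k * real n ^ (card (verts H) - 1))"
proof -
  let ?v = "card (verts H)" and ?C = "complete_copies n"
  define X where "X S = {K \<in> ?C. verts K \<inter> \<Union>(verts ` S) = {}}" for S :: "nat graph set"
  have finX: "finite (X S)" for S using finite_complete_copies by (simp add: X_def)
  have cX: "real (card (X S)) \<ge> real (card ?C) - real ?v ^ 2 * real k * real n ^ (?v - 1)"
    if S: "S \<in> disjoint_families n k" for S
  proof -
    let ?W = "\<Union>(verts ` S)"
    have S': "S \<subseteq> ?C" "card S = k" using S by (auto simp: disjoint_families_def)
    have finS: "finite S" using S' finite_complete_copies finite_subset by blast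
    have finW: "finite ?W"
      using finS connected_regular_graph.finite_verts[OF complete_copy_props(1)] S' by blast
    have "card ?W \<le> (\<Sum>K\<in>S. card (verts K))" by (rule card_UN_le[OF finS])
    also have "\<dots> = (\<Sum>K\<in>S. ?v)" by (intro sum.cong) (use complete_copy_props(2) S' in auto)
    finally have cW: "card ?W \<le> k * ?v" using S' by simp
    let ?P = "\<lambda>w. PiE (verts H) (\<lambda>u. if u = w then ?W else {1..n})"
    have finP: "finite (?P w)" for w using finite_verts finW by (intro finite_PiE) auto
    have "?C - X S \<subseteq> (\<lambda>f. (f ` verts H, (`) f ` edges H)) ` (\<Union>w\<in>verts H. ?P w)"
    proof
      fix K assume K: "K \<in> ?C - X S"
      then obtain f where f: "f \<in> verts H \<rightarrow>\<^sub>E {1..n}" "K = (f ` verts H, (`) f ` edges H)"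
        using copies_subset_image[of "({1..n}, all_pairs {1..n})"] unfolding complete_copies_def by auto
      have "verts K \<inter> ?W \<noteq> {}" using K by (auto simp: X_def)
      then obtain w where w: "w \<in> verts H" "f w \<in> ?W" using f by auto
      then have "f \<in> ?P w" using f by (auto simp: PiE_iff)
      then show "K \<in> (\<lambda>f. (f ` verts H, (`) f ` edges H)) ` (\<Union>w\<in>verts H. ?P w)"
        using w f by blast
    qed
    then have "card (?C - X S) \<le> card (\<Union>w\<in>verts H. ?P w)"
      by (rule surj_card_le[rotated]) (use finite_verts finP in auto)
    also have "\<dots> \<le> (\<Sum>w\<in>verts H. card (?P w))" by (rule card_UN_le[OF finite_verts])
    also have "\<dots> = (\<Sum>w\<in>verts H. card ?W * n ^ (?v - 1))"
    proof (intro sum.cong refl)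
      fix w assume w: "w \<in> verts H"
      have "card (?P w) = (\<Prod>u\<in>verts H. if u = w then card ?W else n)"
        using finite_verts by (subst card_PiE) (auto intro!: prod.cong)
      also have "\<dots> = card ?W * n ^ (?v - 1)"
        using w finite_verts by (subst prod.remove[OF _ w]) (auto simp: card_Diff_singleton)
      finally show "card (?P w) = card ?W * n ^ (?v - 1)" .
    qed
    also have "\<dots> = ?v * (card ?W * n ^ (?v - 1))" by simp
    also have "\<dots> \<le> ?v * (k * ?v * n ^ (?v - 1))" using cW by (intro mult_left_mono mult_right_mono) auto
    finally have "real (card (?C - X S)) \<le> real (?v * (k * ?v * n ^ (?v - 1)))" by (rule of_nat_mono)
    moreover have "real (card (?C - X S)) = real (card ?C) - real (card (X S))"
      using finX card_mono[OF finite_complete_copies, of "X S" n]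
      by (subst card_Diff_subset) (auto simp: X_def of_nat_diff)
    ultimately show ?thesis by (simp add: power2_eq_square mult.assoc mult.commute mult.left_commute)
  qed
  let ?T = "Sigma (disjoint_families n k) X"
  let ?R = "Sigma (disjoint_families n (Suc k)) (\<lambda>S. S)"
  have "card ?T \<le> card ?R"
  proof (rule card_inj_on_le[of "\<lambda>(S, K). (insert K S, K)"])
    have notin: "K \<notin> S" if "K \<in> X S" for K S
    proof
      assume "K \<in> S"
      then have "verts K = {}" using that by (auto simp: X_def)
      then show False using that complete_copy_props(2)[of K n] card_verts_ge_3 by (auto simp: X_def)
    qed
    show "inj_on (\<lambda>(S, K). (insert K S, K)) ?T"
      using notin by (auto simp: inj_on_def insert_ident)
    show "(\<lambda>(S, K). (insert K S, K)) ` ?T \<subseteq> ?R"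
    proof (rule image_subsetI)
      fix x assume "x \<in> ?T"
      then obtain S K where S: "S \<in> disjoint_families n k" "K \<in> X S" and x: "x = (S, K)" by blast
      have "finite S" using S finite_complete_copies finite_subset by (auto simp: disjoint_families_def)
      have "verts K \<inter> verts L = {}" if "L \<in> S" for L using S(2) that by (auto simp: X_def)
      then have "pairwise (\<lambda>K L. verts K \<inter> verts L = {}) (insert K S)"
        using S(1) unfolding pairwise_insert disjoint_families_def by (auto simp: Int_commute)
      then have "insert K S \<in> disjoint_families n (Suc k)"
        using S notin[OF S(2)] \<open>finite S\<close> by (simp add: disjoint_families_def X_def)
      then show "(case x of (S, K) \<Rightarrow> (insert K S, K)) \<in> ?R" unfolding x by simp
    qed
    show "finite ?R"
      using finite_disjoint_families finite_complete_copies
      by (intro finite_SigmaI) (auto simp: disjoint_families_def intro: finite_subset)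
  qed
  also have "card ?R = (\<Sum>S\<in>disjoint_families n (Suc k). card S)"
    using finite_disjoint_families finite_complete_copies
    by (intro card_SigmaI) (auto simp: disjoint_families_def intro: finite_subset)
  also have "\<dots> = card (disjoint_families n (Suc k)) * Suc k" by (simp add: disjoint_families_def)
  finally have le: "real (card ?T) \<le> real (card (disjoint_families n (Suc k))) * real (Suc k)"
    by (metis of_nat_le_iff of_nat_mult)
  have "real (card (disjoint_families n k)) *
      (real (card ?C) - real ?v ^ 2 * real k * real n ^ (?v - 1)) \<le>
      (\<Sum>S\<in>disjoint_families n k. real (card (X S)))"
    using sum_mono[of "disjoint_families n k" "\<lambda>_. real (card ?C) - real ?v ^ 2 * real k * real n ^ (?v - 1)"] cX
    by simp
  also have "\<dots> = real (card ?T)"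
    using finite_disjoint_families finX by (subst card_SigmaI) auto
  finally show ?thesis using le by simp
qed

text \<open>\<open>b\<close> is taken at the final \<open>k\<close>, where the bound is smallest, so
  every step up to \<open>k\<close> contributes at least the same factor.\<close>

lemma card_disjoint_families_ge:
  assumes "b = real (card (complete_copies n)) - real (card (verts H)) ^ 2 * real k * real n ^ (card (verts H) - 1)"
    and "b \<ge> 0" "i \<le> k"
  shows "real (card (disjoint_families n i)) * fact i \<ge> b ^ i"
  using assms(3)
proof (induction i)
  case 0
  have "disjoint_families n 0 = {{}}"
    using finite_subset[OF _ finite_complete_copies, of _ n] card_0_eq
    by (auto simp: disjoint_families_def)
  then show ?case by simp
next
  case (Suc i)
  let ?b = "real (card (complete_copies n)) - real (card (verts H)) ^ 2 * real i * real n ^ (card (verts H) - 1)"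
  have "b \<le> ?b" using assms Suc.prems by (auto intro!: mult_right_mono mult_left_mono)
  have "b ^ Suc i \<le> (real (card (disjoint_families n i)) * fact i) * b"
    using Suc assms(2) by (simp add: mult.commute mult_left_mono)
  also have "\<dots> \<le> (real (card (disjoint_families n i)) * fact i) * ?b"
    using \<open>b \<le> ?b\<close> by (intro mult_left_mono) auto
  also have "\<dots> = fact i * (real (card (disjoint_families n i)) * ?b)" by (simp add: mult_ac)
  also have "\<dots> \<le> fact i * (real (card (disjoint_families n (Suc i))) * real (Suc i))"
    by (intro mult_left_mono card_disjoint_families_Suc) simp
  finally show ?case by (simp add: mult_ac)
qed

lemma prob_copy_count_ge:
  assumes p: "0 \<le> p" "p < 1" and "x \<le> real k"
    and b: "b = real (card (complete_copies n)) - real (card (verts H)) ^ 2 * real k * real n ^ (card (verts H) - 1)"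
    and "b \<ge> 0"
  shows "measure_pmf.prob (gnp n p) {G. copy_count H G \<ge> x} \<ge>
    (b * p ^ card (edges H)) ^ k / fact k * exp (- ((mean_copies n p + overlap_error n k p) / (1 - p)))"
proof -
  let ?P = "measure_pmf.prob (gnp n p)"
  let ?e = "exp (- ((mean_copies n p + overlap_error n k p) / (1 - p)))"
  let ?D = "disjoint_families n k"
  have "(b * p ^ card (edges H)) ^ k / fact k * ?e = b ^ k / fact k * (p ^ (card (edges H) * k) * ?e)"
    by (simp add: power_mult_distrib power_mult)
  also have "\<dots> \<le> real (card ?D) * (p ^ (card (edges H) * k) * ?e)"
    using card_disjoint_families_ge[OF b \<open>b \<ge> 0\<close> order_refl] p
    by (intro mult_right_mono) (auto simp: field_simps)
  also have "\<dots> = (\<Sum>S\<in>?D. p ^ (card (edges H) * k) * ?e)" by simp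
  also have "\<dots> \<le> (\<Sum>S\<in>?D. ?P {G. copies H G = S})"
    by (intro sum_mono prob_copies_eq_ge) (use p in auto)
  also have "\<dots> = ?P (\<Union>S\<in>?D. {G. copies H G = S})"
    by (rule measure_pmf.finite_measure_finite_Union[symmetric])
      (auto simp: finite_disjoint_families disjoint_family_on_def)
  also have "\<dots> \<le> ?P {G. copy_count H G \<ge> x}"
    using \<open>x \<le> real k\<close>
    by (intro measure_pmf.finite_measure_mono) (auto simp: copy_count_def disjoint_families_def)
  finally show ?thesis .
qed

end

section \<open>Asymptotics\<close>

lemma polylog_over_power_tendsto_0:
  assumes "c > 0"
  shows "(\<lambda>n. ln (real n) ^ a * real n powr (- c)) \<longlonglongrightarrow> 0"
proof -
  have "(\<lambda>n. ln (real n) powr real a * real n powr (- c)) \<longlonglongrightarrow> 0"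
    using assms by real_asymp
  moreover have "\<forall>\<^sub>F n in sequentially. ln (real n) powr real a * real n powr (- c) = ln (real n) ^ a * real n powr (- c)"
    using eventually_gt_at_top[of 1] by eventually_elim (simp add: powr_realpow)
  ultimately show ?thesis by (rule Lim_transform_eventually)
qed

text \<open>A Stirling bound whose error, logarithmic in \<open>k\<close>, vanishes after division
  by the mean.\<close>

lemma ln_fact_le:
  assumes "k > 0"
  shows "ln (fact k) \<le> real k * ln (real k) - real k + ln (real k) + 1"
  using assms
proof (induction k)
  case (Suc k)
  show ?case
  proof (cases "k = 0")
    case False
    have "1 / real (Suc k) \<le> ln (real (Suc k) / real k)"
      using ln_le_minus_one[of "real k / real (Suc k)"] False
      by (simp add: ln_div field_simps)
    then have "1 \<le> real (Suc k) * (ln (real (Suc k)) - ln (real k))"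
      using False by (simp add: ln_div field_simps)
    moreover have "ln (fact (Suc k)) = ln (real (Suc k)) + ln (fact k)"
      unfolding fact_Suc by (subst ln_mult) (auto simp del: of_nat_Suc)
    ultimately show ?thesis using Suc False by (simp add: algebra_simps)
  qed simp
qed simp

section \<open>The range of p and the resulting orders of m and \<mu>\<close>

locale poisson_regime = connected_regular_graph H \<Delta> for H :: "'a graph" and \<Delta> +
  fixes p :: "nat \<Rightarrow> real"
  assumes p_nonneg: "0 \<le> p n" and p_le_1: "p n \<le> 1"
    and p_lower: "(\<lambda>n. 1 / real n) \<in> o(\<lambda>n. p n powr (real \<Delta> / 2))"
    and p_upper: "(\<lambda>n. p n powr (real \<Delta> / 2)) \<in>
      o(\<lambda>n. 1 / real n * ln (real n) powr (1 / (real (card (verts H)) - 2)))"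
begin

abbreviation "v \<equiv> card (verts H)"
abbreviation "h \<equiv> card (edges H)"

definition m :: "nat \<Rightarrow> real" where "m n = real n * p n powr (real \<Delta> / 2)"

definition \<mu> :: "nat \<Rightarrow> real" where "\<mu> n = mean_copies n (p n)"

lemma \<Delta>_pos: "real \<Delta> > 0" using degree_ge_2 by simp

lemma v_pos: "real v > 0" using card_verts_ge_3 by simp

lemma m_at_top: "filterlim m at_top sequentially"
  unfolding filterlim_at_top
proof
  fix Z :: real
  define c where "c = 1 / max Z 1"
  have c: "c > 0" by (simp add: c_def)
  show "\<forall>\<^sub>F n in sequentially. Z \<le> m n"
    using landau_o.smallD[OF p_lower c] eventually_gt_at_top[of 0]
  proof eventually_elim
    case (elim n)
    then have "1 / real n \<le> c * p n powr (real \<Delta> / 2)" by simp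
    then have "1 \<le> c * m n" using elim(2) by (simp add: m_def field_simps)
    then have "max Z 1 \<le> m n" by (simp add: c_def field_simps)
    then show ?case by simp
  qed
qed

lemma m_ge_1: "\<forall>\<^sub>F n in sequentially. 1 \<le> m n"
  using m_at_top by (simp add: filterlim_at_top)

text \<open>\<open>p_upper\<close> is used only here, raised to the power \<open>v - 2\<close>. In
  effect m^v is small compared to m^2 ln n, which sets the mean against the cost of a
  cluster.\<close>

lemma m_power_le:
  assumes "c > 0"
  shows "\<forall>\<^sub>F n in sequentially. m n ^ (v - 2) \<le> c * ln (real n)"
proof -
  let ?k = "v - 2"
  have k: "?k > 0" "real v - 2 = real ?k" using card_verts_ge_3 by auto
  have root: "(x powr (1 / real ?k)) ^ ?k = x" if "x > 0" for x :: real
    using that k by (simp add: powr_realpow[symmetric] powr_powr)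
  have c: "c powr (1 / real ?k) > 0" using assms by simp
  show ?thesis
    using landau_o.smallD[OF p_upper c] eventually_gt_at_top[of 1]
  proof eventually_elim
    case (elim n)
    then have "p n powr (real \<Delta> / 2) \<le> c powr (1 / real ?k) * (1 / real n * ln (real n) powr (1 / real ?k))"
      by (simp add: k)
    then have "m n \<le> c powr (1 / real ?k) * ln (real n) powr (1 / real ?k)"
      using elim(2) by (simp add: m_def field_simps)
    then have "m n ^ ?k \<le> (c powr (1 / real ?k) * ln (real n) powr (1 / real ?k)) ^ ?k"
      by (intro power_mono) (auto simp: m_def)
    also have "\<dots> = c * ln (real n)"
      using elim(2) assms by (simp add: power_mult_distrib root)
    finally show ?case .
  qed
qed

lemma m_le_ln: "\<forall>\<^sub>F n in sequentially. m n \<le> ln (real n)"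
  using m_power_le[of 1, simplified] m_ge_1
proof eventually_elim
  case (elim n)
  have "m n ^ 1 \<le> m n ^ (v - 2)" using elim(2) card_verts_ge_3 by (intro power_increasing) auto
  then show ?case using elim(1) by simp
qed

text \<open>\<open>m n \<ge> 1\<close> excludes \<open>p n = 0\<close>, after which p is a power of
  m/n. The quantifier over \<open>a\<close> stands inside the eventuality because later exponents
  vary with \<open>n\<close>.\<close>

lemma p_powr: "\<forall>\<^sub>F n in sequentially. 0 < p n \<and> (\<forall>a. p n powr a = (m n / real n) powr (2 * a / real \<Delta>))"
  using m_ge_1 eventually_gt_at_top[of 0]
proof eventually_elim
  case (elim n)
  then have "p n \<noteq> 0" by (auto simp: m_def)
  then have pos: "0 < p n" using p_nonneg[of n] by simp
  have "p n powr a = (m n / real n) powr (2 * a / real \<Delta>)" for a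
    using pos elim \<Delta>_pos by (simp add: m_def powr_powr)
  with pos show ?case by simp
qed

text \<open>The handshake identity makes the expected number of copies a power of m alone, up to
  constants.\<close>

lemma p_power_h: "\<forall>\<^sub>F n in sequentially. p n ^ h = (m n / real n) ^ v"
  using p_powr m_ge_1 eventually_gt_at_top[of 0]
proof eventually_elim
  case (elim n)
  have "2 * real h = real \<Delta> * real v" using handshake by (metis of_nat_mult of_nat_numeral)
  then have "2 * real h / real \<Delta> = real v" using \<Delta>_pos by (simp add: field_simps)
  moreover have "p n ^ h = p n powr real h" using elim(1)[THEN conjunct1] by (simp add: powr_realpow)
  moreover have "p n powr real h = (m n / real n) powr (2 * real h / real \<Delta>)" using elim by blast
  ultimately show ?case using elim by (simp add: powr_realpow)
qed

lemma \<mu>_le: "\<forall>\<^sub>F n in sequentially. \<mu> n \<le> m n ^ v"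
  using p_power_h m_ge_1 eventually_gt_at_top[of 0]
proof eventually_elim
  case (elim n)
  have "\<mu> n = real (card (complete_copies n)) * (m n / real n) ^ v"
    by (simp add: \<mu>_def mean_copies_def elim)
  also have "\<dots> \<le> real (n ^ v) * (m n / real n) ^ v"
    using elim by (intro mult_right_mono of_nat_mono card_complete_copies_le) auto
  also have "\<dots> = m n ^ v" using elim by (simp add: power_divide)
  finally show ?case .
qed

lemma \<mu>_ge: "\<forall>\<^sub>F n in sequentially. (m n / real v) ^ v \<le> \<mu> n"
  using p_power_h m_ge_1 eventually_gt_at_top[of 0] eventually_ge_at_top[of v]
proof eventually_elim
  case (elim n)
  have "(m n / real v) ^ v = (real n / real v) ^ v * (m n / real n) ^ v"
    using elim by (simp add: power_divide)
  also have "\<dots> \<le> real (card (complete_copies n)) * (m n / real n) ^ v"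
    using elim by (intro mult_right_mono card_complete_copies_ge) auto
  also have "\<dots> = \<mu> n" by (simp add: \<mu>_def mean_copies_def elim)
  finally show ?case .
qed

lemma \<mu>_at_top: "filterlim \<mu> at_top sequentially"
proof (rule filterlim_at_top_mono)
  show "filterlim (\<lambda>n. m n / real v) at_top sequentially"
    using filterlim_tendsto_pos_mult_at_top[OF tendsto_const _ m_at_top, of "1 / real v"] v_pos by simp
  show "\<forall>\<^sub>F n in sequentially. m n / real v \<le> \<mu> n"
    using \<mu>_ge filterlim_at_top[THEN iffD1, OF \<open>filterlim (\<lambda>n. m n / real v) at_top sequentially\<close>, rule_format, of 1]
  proof eventually_elim
    case (elim n)
    have "(m n / real v) ^ 1 \<le> (m n / real v) ^ v"
      using elim card_verts_ge_3 by (intro power_increasing) auto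
    then show ?case using elim by simp
  qed
qed

lemma \<mu>_le_polylog: "\<forall>\<^sub>F n in sequentially. \<mu> n \<le> ln (real n) ^ v"
  using \<mu>_le m_le_ln m_ge_1
proof eventually_elim
  case (elim n)
  have "m n ^ v \<le> ln (real n) ^ v" using elim by (intro power_mono) auto
  then show ?case using elim by simp
qed

lemma \<mu>_ge_1: "\<forall>\<^sub>F n in sequentially. 1 \<le> \<mu> n"
  using \<mu>_at_top by (simp add: filterlim_at_top)

lemma p_tendsto_0: "p \<longlonglongrightarrow> 0"
proof -
  have c: "2 / real \<Delta> > 0" using \<Delta>_pos by simp
  have lim: "(\<lambda>n. (ln (real n) / real n) powr (2 / real \<Delta>)) \<longlonglongrightarrow> 0"
    using c by real_asymp
  have le: "\<forall>\<^sub>F n in sequentially. p n \<le> (ln (real n) / real n) powr (2 / real \<Delta>)"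
    using p_powr m_le_ln m_ge_1 eventually_gt_at_top[of 0]
  proof eventually_elim
    case (elim n)
    have "p n = p n powr 1" using elim by simp
    also have "\<dots> = (m n / real n) powr (2 / real \<Delta>)" using elim by (metis mult.right_neutral)
    also have "\<dots> \<le> (ln (real n) / real n) powr (2 / real \<Delta>)"
      using elim c by (intro powr_mono2 divide_right_mono) auto
    finally show ?case .
  qed
  show ?thesis
    by (rule tendsto_sandwich[OF _ le tendsto_const lim]) (simp add: p_nonneg)
qed

end

lemma powr_divide_conv_mult:
  fixes x y a :: real
  shows "0 \<le> x \<Longrightarrow> 0 \<le> y \<Longrightarrow> (x / y) powr a = x powr a * y powr (- a)"
  by (simp add: powr_divide powr_minus_divide)

context poisson_regime
begin

section \<open>Lower bound for the tail probability\<close>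

definition upper_tail :: "real \<Rightarrow> nat \<Rightarrow> real" where
  "upper_tail \<delta> n = measure_pmf.prob (gnp n (p n)) {G. copy_count H G \<ge> (1 + \<delta>) * \<mu> n}"

definition family_size :: "real \<Rightarrow> nat \<Rightarrow> nat" where
  "family_size \<delta> n = nat \<lceil>(1 + \<delta>) * \<mu> n\<rceil>"

lemma family_size_bounds:
  assumes "\<delta> > 0" "\<mu> n \<ge> 1"
  shows "(1 + \<delta>) * \<mu> n \<le> real (family_size \<delta> n)" "real (family_size \<delta> n) \<le> (1 + \<delta>) * \<mu> n + 1"
    and "real (family_size \<delta> n) \<le> (2 + \<delta>) * \<mu> n" "family_size \<delta> n > 0"
proof -
  have "(1 + \<delta>) * \<mu> n > 0" using assms by simp
  then show "(1 + \<delta>) * \<mu> n \<le> real (family_size \<delta> n)" "real (family_size \<delta> n) \<le> (1 + \<delta>) * \<mu> n + 1"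
      "family_size \<delta> n > 0"
    unfolding family_size_def by linarith+
  then show "real (family_size \<delta> n) \<le> (2 + \<delta>) * \<mu> n" using assms by (simp add: algebra_simps)
qed

lemma family_size_ratio:
  assumes "\<delta> > 0"
  shows "(\<lambda>n. real (family_size \<delta> n) / \<mu> n) \<longlonglongrightarrow> 1 + \<delta>"
proof (rule tendsto_sandwich)
  show "\<forall>\<^sub>F n in sequentially. 1 + \<delta> \<le> real (family_size \<delta> n) / \<mu> n"
    using \<mu>_ge_1 by eventually_elim (use family_size_bounds[OF assms] in \<open>auto simp: field_simps\<close>)
  show "\<forall>\<^sub>F n in sequentially. real (family_size \<delta> n) / \<mu> n \<le> 1 + \<delta> + inverse (\<mu> n)"
    using \<mu>_ge_1 by eventually_elim (use family_size_bounds[OF assms] in \<open>auto simp: field_simps\<close>)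
  show "(\<lambda>n. 1 + \<delta> + inverse (\<mu> n)) \<longlonglongrightarrow> 1 + \<delta>"
    using tendsto_add[OF tendsto_const tendsto_inverse_0_at_top[OF \<mu>_at_top], of "1 + \<delta>"] by simp
qed simp

lemma family_size_at_top:
  assumes "\<delta> > 0"
  shows "filterlim (\<lambda>n. real (family_size \<delta> n)) at_top sequentially"
proof (rule filterlim_at_top_mono[OF \<mu>_at_top])
  show "\<forall>\<^sub>F n in sequentially. \<mu> n \<le> real (family_size \<delta> n)"
    using \<mu>_ge_1
  proof eventually_elim
    case (elim n)
    have "0 \<le> \<delta> * \<mu> n" using assms elim by simp
    then show ?case using family_size_bounds(1)[OF assms elim] by (simp add: algebra_simps)
  qed
qed

lemma family_size_polylog:
  assumes "\<delta> > 0"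
  shows "\<forall>\<^sub>F n in sequentially. real (family_size \<delta> n) \<le> (2 + \<delta>) * ln (real n) ^ v"
  using \<mu>_ge_1 \<mu>_le_polylog
proof eventually_elim
  case (elim n)
  have "(2 + \<delta>) * \<mu> n \<le> (2 + \<delta>) * ln (real n) ^ v" using assms elim by (intro mult_left_mono) auto
  then show ?case using family_size_bounds(3)[OF assms elim(1)] by simp
qed

text \<open>An upper bound for the fraction of copies that meet one of \<open>family_size \<delta> n\<close> given copies.\<close>

definition hit_fraction :: "real \<Rightarrow> nat \<Rightarrow> real" where
  "hit_fraction \<delta> n = real v ^ 2 * real (family_size \<delta> n) * real n ^ (v - 1) / real (card (complete_copies n))"

text \<open>Disjointness costs at most a factor (1 - hit fraction)^k in the count of families. The
  family size is polylogarithmic and the hit fraction is of order k/n, so this factor tends to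
  1.\<close>

lemma family_size_times_hit_fraction:
  assumes "\<delta> > 0"
  shows "(\<lambda>n. real (family_size \<delta> n) * hit_fraction \<delta> n) \<longlonglongrightarrow> 0"
proof -
  let ?C = "real v ^ 2 * real v ^ v * (2 + \<delta>) ^ 2"
  have lim: "(\<lambda>n. ?C * (ln (real n) ^ (2 * v) * real n powr (- 1))) \<longlonglongrightarrow> 0"
    by (intro tendsto_mult_right_zero polylog_over_power_tendsto_0) simp
  have le: "\<forall>\<^sub>F n in sequentially. real (family_size \<delta> n) * hit_fraction \<delta> n \<le> ?C * (ln (real n) ^ (2 * v) * real n powr (- 1))"
    using family_size_polylog[OF assms] eventually_ge_at_top[of v] eventually_gt_at_top[of 0]
  proof eventually_elim
    case (elim n)
    let ?k = "real (family_size \<delta> n)" and ?M = "real (card (complete_copies n))"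
    have "(real n / real v) ^ v > 0" using elim v_pos by simp
    moreover have M: "(real n / real v) ^ v \<le> ?M" by (rule card_complete_copies_ge) (use elim in simp)
    ultimately have "real n ^ (v - 1) / ?M \<le> real n ^ (v - 1) / (real n / real v) ^ v"
      by (intro divide_left_mono) auto
    also have "\<dots> = real v ^ v / real n"
    proof -
      have "real n ^ v = real n * real n ^ (v - 1)"
        using card_verts_ge_3 by (metis Suc_diff_1 gr0I not_numeral_le_zero power_Suc)
      then show ?thesis using elim by (simp add: power_divide)
    qed
    finally have "?k ^ 2 * real v ^ 2 * (real n ^ (v - 1) / ?M) \<le> ?k ^ 2 * real v ^ 2 * (real v ^ v / real n)"
      by (intro mult_left_mono) auto
    also have "\<dots> \<le> ((2 + \<delta>) * ln (real n) ^ v) ^ 2 * real v ^ 2 * (real v ^ v / real n)"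
      using elim by (intro mult_right_mono power_mono) auto
    also have "\<dots> = ?C * (ln (real n) ^ (2 * v) * real n powr (- 1))"
    proof -
      have "((2 + \<delta>) * ln (real n) ^ v) ^ 2 = (2 + \<delta>) ^ 2 * ln (real n) ^ (2 * v)"
        by (simp add: power_mult_distrib mult.commute flip: power_mult)
      then show ?thesis using elim by (simp add: powr_minus_divide)
    qed
    finally show ?case by (simp add: hit_fraction_def power2_eq_square mult_ac)
  qed
  show ?thesis
    by (rule tendsto_sandwich[OF _ le tendsto_const lim]) (simp add: hit_fraction_def)
qed

text \<open>In each term the powers of n combine to at most n^(-1/\<Delta>), by the deficiency of a
  proper edge subset, and all other factors are polylogarithmic.\<close>

lemma overlap_error_tendsto_0:
  assumes "\<delta> > 0"
  shows "(\<lambda>n. overlap_error n (family_size \<delta> n) (p n)) \<longlonglongrightarrow> 0"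
  unfolding overlap_error_def
proof (rule tendsto_null_sum)
  fix J assume "J \<in> Pow (edges H) - {{}, edges H}"
  then have J: "J \<subseteq> edges H" "J \<noteq> {}" "J \<noteq> edges H" by auto
  let ?j = "card (\<Union>J)" and ?i = "card J"
  let ?f = "\<lambda>n. real (family_size \<delta> n * v) ^ ?j * real n ^ (v - ?j) * p n ^ (h - ?i)"
  let ?C = "((2 + \<delta>) * real v) ^ ?j"
  have "\<Union>J \<subseteq> verts H" using J edge_subset by blast
  then have jv: "?j \<le> v" using finite_verts by (rule card_mono[rotated])
  have ih: "?i \<le> h" using J finite_edges by (intro card_mono) auto
  have def: "2 * real ?i + 1 \<le> real \<Delta> * real ?j"
    using of_nat_mono[OF proper_edge_subset_deficient[OF J], where 'a = real] by simp
  have hv: "2 * real h = real \<Delta> * real v" using handshake by (metis of_nat_mult of_nat_numeral)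
  have lim: "(\<lambda>n. ?C * (ln (real n) ^ (v * ?j + v) * real n powr (- (1 / real \<Delta>)))) \<longlonglongrightarrow> 0"
    by (intro tendsto_mult_right_zero polylog_over_power_tendsto_0) (use \<Delta>_pos in simp)
  have le: "\<forall>\<^sub>F n in sequentially. ?f n \<le> ?C * (ln (real n) ^ (v * ?j + v) * real n powr (- (1 / real \<Delta>)))"
    using family_size_polylog[OF assms] p_powr m_ge_1 m_le_ln eventually_gt_at_top[of 0]
  proof eventually_elim
    case (elim n)
    let ?L = "ln (real n)" and ?e = "real v - 2 * real ?i / real \<Delta>"
    have e: "2 * real (h - ?i) / real \<Delta> = ?e"
      using ih hv \<Delta>_pos by (simp add: of_nat_diff diff_divide_distrib right_diff_distrib)
    have "p n ^ (h - ?i) = p n powr real (h - ?i)"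
      using elim(2)[THEN conjunct1] by (simp add: powr_realpow)
    also have "\<dots> = (m n / real n) powr ?e" using elim(2) e by metis
    also have "\<dots> = m n powr ?e * real n powr (- ?e)"
      using elim(3,5) by (intro powr_divide_conv_mult) auto
    finally have "real n ^ (v - ?j) * p n ^ (h - ?i) =
        m n powr ?e * (real n powr real (v - ?j) * real n powr (- ?e))"
      using elim by (simp add: powr_realpow mult_ac)
    also have "real n powr real (v - ?j) * real n powr (- ?e) = real n powr (2 * real ?i / real \<Delta> - real ?j)"
      using jv by (simp add: powr_add[symmetric] of_nat_diff)
    also have "m n powr ?e * real n powr (2 * real ?i / real \<Delta> - real ?j) \<le> ?L ^ v * real n powr (- (1 / real \<Delta>))"
    proof (intro mult_mono)
      have "m n powr ?e \<le> m n powr real v" using elim \<Delta>_pos by (intro powr_mono) auto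
      also have "\<dots> = m n ^ v" using elim by (simp add: powr_realpow)
      also have "\<dots> \<le> ?L ^ v" using elim by (intro power_mono) auto
      finally show "m n powr ?e \<le> ?L ^ v" .
      have "2 * real ?i / real \<Delta> - real ?j \<le> - (1 / real \<Delta>)"
        using divide_right_mono[OF def, of "real \<Delta>"] \<Delta>_pos by (simp add: add_divide_distrib)
      then show "real n powr (2 * real ?i / real \<Delta> - real ?j) \<le> real n powr (- (1 / real \<Delta>))"
        using elim by (intro powr_mono) auto
    qed (use elim in auto)
    finally have 1: "real n ^ (v - ?j) * p n ^ (h - ?i) \<le> ?L ^ v * real n powr (- (1 / real \<Delta>))" .
    have 2: "real (family_size \<delta> n * v) ^ ?j \<le> ((2 + \<delta>) * ?L ^ v * real v) ^ ?j"
      using elim by (intro power_mono) (auto intro!: mult_right_mono)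
    have "?f n = real (family_size \<delta> n * v) ^ ?j * (real n ^ (v - ?j) * p n ^ (h - ?i))" by (simp add: mult_ac)
    also have "\<dots> \<le> ((2 + \<delta>) * ?L ^ v * real v) ^ ?j * (?L ^ v * real n powr (- (1 / real \<Delta>)))"
      by (rule mult_mono[OF 2 1]) (use elim assms p_nonneg in auto)
    also have "\<dots> = ?C * (?L ^ (v * ?j + v) * real n powr (- (1 / real \<Delta>)))"
      by (simp add: power_mult_distrib power_add mult_ac flip: power_mult)
    finally show ?case .
  qed
  show "?f \<longlonglongrightarrow> 0"
    by (rule tendsto_sandwich[OF _ le tendsto_const lim]) (simp add: p_nonneg)
qed

text \<open>Positivity belongs to the conclusion because \<open>ln 0 = 0\<close>: a vanishing
  probability would otherwise look like probability 1.\<close>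

lemma upper_tail_ge:
  assumes "\<delta> > 0"
  obtains U where "\<forall>\<^sub>F n in sequentially. upper_tail \<delta> n > 0 \<and> - ln (upper_tail \<delta> n) / \<mu> n \<le> U n"
    and "U \<longlonglongrightarrow> (1 + \<delta>) * ln (1 + \<delta>) - \<delta>"
proof -
  define r where "r n = real (family_size \<delta> n) / \<mu> n" for n
  define err where "err n = overlap_error n (family_size \<delta> n) (p n)" for n
  \<comment> \<open>The first four terms come from the power of \<mu> against the factorial, the
    next from disjointness, the last from excluding further copies. The last tends to 1 and turns
    -(1 + \<delta>) into -\<delta>.\<close>
  define U where "U n = r n * ln (r n) - r n + ln (real (family_size \<delta> n)) / real (family_size \<delta> n) * r n
    + inverse (\<mu> n) + 2 * (real (family_size \<delta> n) * hit_fraction \<delta> n) * inverse (\<mu> n)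
    + (1 + err n * inverse (\<mu> n)) / (1 - p n)" for n
  have r: "r \<longlonglongrightarrow> 1 + \<delta>" unfolding r_def by (rule family_size_ratio[OF assms])
  have inv: "(\<lambda>n. inverse (\<mu> n)) \<longlonglongrightarrow> 0" by (rule tendsto_inverse_0_at_top[OF \<mu>_at_top])
  have lnk: "(\<lambda>n. ln (real (family_size \<delta> n)) / real (family_size \<delta> n)) \<longlonglongrightarrow> 0"
    by (rule filterlim_compose[OF _ family_size_at_top[OF assms]]) real_asymp
  have "U \<longlonglongrightarrow> (1 + \<delta>) * ln (1 + \<delta>) - (1 + \<delta>) + 0 * (1 + \<delta>) + 0 + 2 * 0 * 0 + (1 + 0 * 0) / (1 - 0)"
    unfolding U_def err_def
    using assms
    by (intro tendsto_intros r inv lnk family_size_times_hit_fraction overlap_error_tendsto_0 p_tendsto_0) auto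
  then have lim: "U \<longlonglongrightarrow> (1 + \<delta>) * ln (1 + \<delta>) - \<delta>" by (simp add: algebra_simps)
  have small: "\<forall>\<^sub>F n in sequentially. real (family_size \<delta> n) * hit_fraction \<delta> n < 1 / 2"
    by (rule order_tendstoD(2)[OF family_size_times_hit_fraction[OF assms]]) simp
  have p1: "\<forall>\<^sub>F n in sequentially. p n < 1" by (rule order_tendstoD(2)[OF p_tendsto_0]) simp
  have "\<forall>\<^sub>F n in sequentially. upper_tail \<delta> n > 0 \<and> - ln (upper_tail \<delta> n) / \<mu> n \<le> U n"
    using small p1 \<mu>_ge_1
  proof eventually_elim
    case (elim n)
    let ?k = "family_size \<delta> n" and ?\<epsilon> = "hit_fraction \<delta> n" and ?M = "real (card (complete_copies n))"
    define b where "b = ?M - real v ^ 2 * real ?k * real n ^ (v - 1)"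
    have kpos: "?k > 0" and kge: "(1 + \<delta>) * \<mu> n \<le> real ?k" using family_size_bounds[OF assms elim(3)] by auto
    have Mpos: "?M > 0"
    proof (rule ccontr)
      assume "\<not> ?thesis"
      then have "\<mu> n = 0" by (simp add: \<mu>_def mean_copies_def)
      then show False using elim by simp
    qed
    have \<epsilon>0: "?\<epsilon> \<ge> 0" by (simp add: hit_fraction_def)
    have "1 * ?\<epsilon> \<le> real ?k * ?\<epsilon>" using kpos \<epsilon>0 by (intro mult_right_mono) auto
    then have \<epsilon>: "?\<epsilon> \<le> 1 / 2" using elim by simp
    have b: "b = ?M * (1 - ?\<epsilon>)" using Mpos by (simp add: b_def hit_fraction_def field_simps)
    have "b \<ge> 0" unfolding b using Mpos \<epsilon> by simp
    have bp: "b * p n ^ h = \<mu> n * (1 - ?\<epsilon>)" unfolding b by (simp add: \<mu>_def mean_copies_def)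
    let ?A = "(\<mu> n * (1 - ?\<epsilon>)) ^ ?k / fact ?k * exp (- ((\<mu> n + err n) / (1 - p n)))"
    have A: "?A \<le> upper_tail \<delta> n"
      using prob_copy_count_ge[OF p_nonneg elim(2) kge b_def \<open>b \<ge> 0\<close>]
      unfolding upper_tail_def bp err_def \<mu>_def .
    have x: "\<mu> n * (1 - ?\<epsilon>) > 0" using elim \<epsilon> by simp
    then have Apos: "?A > 0" by simp
    have "ln ?A = ln ((\<mu> n * (1 - ?\<epsilon>)) ^ ?k / fact ?k) - (\<mu> n + err n) / (1 - p n)"
      by (subst ln_mult) (use x in auto)
    also have "ln ((\<mu> n * (1 - ?\<epsilon>)) ^ ?k / fact ?k) = real ?k * ln (\<mu> n * (1 - ?\<epsilon>)) - ln (fact ?k)"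
      using x by (subst ln_div) (auto simp: ln_realpow)
    also have "ln (\<mu> n * (1 - ?\<epsilon>)) = ln (\<mu> n) + ln (1 - ?\<epsilon>)"
      by (subst ln_mult) (use elim \<epsilon> in auto)
    finally have lnA: "ln ?A = real ?k * (ln (\<mu> n) + ln (1 - ?\<epsilon>)) - ln (fact ?k) - (\<mu> n + err n) / (1 - p n)" .
    have "ln (1 - ?\<epsilon>) \<ge> - ?\<epsilon> - 2 * ?\<epsilon>\<^sup>2" by (rule ln_one_minus_pos_lower_bound[OF \<epsilon>0 \<epsilon>])
    moreover have "?\<epsilon> * ?\<epsilon> \<le> ?\<epsilon> * (1 / 2)" using \<epsilon>0 \<epsilon> by (intro mult_left_mono) auto
    ultimately have "ln (1 - ?\<epsilon>) \<ge> - (2 * ?\<epsilon>)" by (simp add: power2_eq_square)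
    then have "real ?k * ln (1 - ?\<epsilon>) \<ge> real ?k * (- (2 * ?\<epsilon>))" by (intro mult_left_mono) auto
    then have "- ln ?A \<le> real ?k * ln (real ?k) - real ?k * ln (\<mu> n) - real ?k + ln (real ?k) + 1
        + 2 * (real ?k * ?\<epsilon>) + (\<mu> n + err n) / (1 - p n)"
      unfolding lnA using ln_fact_le[OF kpos] by (simp add: algebra_simps)
    also have "real ?k * ln (real ?k) - real ?k * ln (\<mu> n) = real ?k * ln (r n)"
      unfolding r_def using kpos elim by (subst ln_div) (auto simp: algebra_simps)
    finally have "- ln ?A / \<mu> n \<le> (real ?k * ln (r n) - real ?k + ln (real ?k) + 1
        + 2 * (real ?k * ?\<epsilon>) + (\<mu> n + err n) / (1 - p n)) / \<mu> n"
      using elim by (intro divide_right_mono) auto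
    also have "\<dots> = U n"
    proof -
      have "(\<mu> n + err n) / (1 - p n) / \<mu> n = (1 + err n * inverse (\<mu> n)) / (1 - p n)"
        using elim by (simp add: field_simps)
      moreover have "ln (real ?k) / \<mu> n = ln (real ?k) / real ?k * r n" "real ?k * ln (r n) / \<mu> n = r n * ln (r n)"
        using kpos by (simp_all add: r_def)
      moreover have "(a - b + c + 1 + e + f) / \<mu> n = a / \<mu> n - b / \<mu> n + c / \<mu> n + 1 / \<mu> n + e / \<mu> n + f / \<mu> n"
        for a b c e f :: real by (simp add: add_divide_distrib diff_divide_distrib)
      ultimately show ?thesis unfolding U_def by (simp only: r_def divide_inverse mult_1_left)
    qed
    finally have U: "- ln ?A / \<mu> n \<le> U n" .
    have "- ln (upper_tail \<delta> n) / \<mu> n \<le> - ln ?A / \<mu> n"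
      using A Apos elim by (intro divide_right_mono) auto
    then show ?case using U A Apos by linarith
  qed
  then show ?thesis using lim that by blast
qed

end

section \<open>Upper bound for the tail probability, and the rate\<close>

context poisson_regime
begin

text \<open>The edge excess turns the exponent \<open>u - 2 e / \<Delta>\<close> of n into at most
  \<open>- 2 \<beta> e\<close>, so the whole term becomes an \<open>e\<close>-th power.\<close>

lemma cluster_term_le:
  assumes ue: "(u, e) \<in> cluster_sizes s" and n: "real n > 0" and m: "m n \<ge> 1" and "p n > 0"
    and pp: "\<And>a. p n powr a = (m n / real n) powr (2 * a / real \<Delta>)"
    and \<beta>: "\<beta> = 1 / ((1 + real \<Delta>) ^ (v + 1) * real \<Delta>)"
  shows "real n ^ u * (real u ^ 2) ^ e * p n ^ e \<le>
    (real n powr (- (2 * \<beta>)) * m n powr (2 / real \<Delta>) * (4 * real s * real h) ^ 2) ^ e"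
proof -
  define c where "c = (1 + real \<Delta>) ^ (v + 1)"
  have c: "c > 0" unfolding c_def by simp
  have "2 * e + (1 + \<Delta>) ^ (v + 1) * (\<Delta> * u) \<le> (1 + \<Delta>) ^ (v + 1) * (2 * e)"
    using ue by (simp add: cluster_sizes_def)
  from of_nat_mono[OF this, where 'a = real]
  have le: "2 * real e + c * (real \<Delta> * real u) \<le> c * (2 * real e)"
    by (simp add: c_def algebra_simps)
  have "real u - 2 * real e / real \<Delta> \<le> - (2 * \<beta>) * real e"
  proof -
    have "(real u - 2 * real e / real \<Delta>) * (c * real \<Delta>) \<le> - (2 * real e)"
      using le \<Delta>_pos by (simp add: algebra_simps)
    then have "real u - 2 * real e / real \<Delta> \<le> - (2 * real e) / (c * real \<Delta>)"
      using c \<Delta>_pos by (subst pos_le_divide_eq) auto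
    then show ?thesis unfolding \<beta> c_def[symmetric] by simp
  qed
  then have 1: "real n powr (real u - 2 * real e / real \<Delta>) \<le> real n powr (- (2 * \<beta>) * real e)"
    using n by (intro powr_mono) auto
  have "p n ^ e = p n powr real e" using \<open>p n > 0\<close> by (simp add: powr_realpow)
  also have "\<dots> = m n powr (2 * real e / real \<Delta>) * real n powr (- (2 * real e / real \<Delta>))"
    unfolding pp using m n by (intro powr_divide_conv_mult) auto
  finally have "real n ^ u * p n ^ e = m n powr (2 * real e / real \<Delta>) * real n powr (real u - 2 * real e / real \<Delta>)"
    using n by (simp add: powr_realpow[symmetric] powr_diff powr_minus divide_inverse)
  also have "\<dots> \<le> m n powr (2 * real e / real \<Delta>) * real n powr (- (2 * \<beta>) * real e)"
    by (intro mult_left_mono 1) auto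
  also have "\<dots> = (real n powr (- (2 * \<beta>)) * m n powr (2 / real \<Delta>)) ^ e"
    using m n by (simp add: power_mult_distrib powr_powr powr_realpow[symmetric])
  finally have 2: "real n ^ u * p n ^ e \<le> (real n powr (- (2 * \<beta>)) * m n powr (2 / real \<Delta>)) ^ e" .
  have "u \<le> 4 * s * h" using ue by (simp add: cluster_sizes_def)
  from of_nat_mono[OF this, where 'a = real] have "real u ^ 2 \<le> (4 * real s * real h) ^ 2"
    by (intro power_mono) auto
  then have 3: "(real u ^ 2) ^ e \<le> ((4 * real s * real h) ^ 2) ^ e" by (intro power_mono) auto
  have "real n ^ u * (real u ^ 2) ^ e * p n ^ e = (real n ^ u * p n ^ e) * (real u ^ 2) ^ e" by (simp add: mult_ac)
  also have "\<dots> \<le> (real n powr (- (2 * \<beta>)) * m n powr (2 / real \<Delta>)) ^ e * ((4 * real s * real h) ^ 2) ^ e"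
    by (rule mult_mono[OF 2 3]) (use n in auto)
  finally show ?thesis by (simp only: power_mult_distrib)
qed

text \<open>One half of n^(-2 \<beta>) absorbs the polylogarithmic factors; the other half, raised
  to the power \<open>e\<close> of order at least m^2, gives exp (-c m^2 ln n), smaller than any exp
  (-K \<mu>).\<close>

lemma prob_overlapping_copies_negligible:
  assumes "\<epsilon> > 0" "K > 0"
  shows "\<forall>\<^sub>F n in sequentially. measure_pmf.prob (gnp n (p n))
    {G. nat \<lceil>\<epsilon> * \<mu> n\<rceil> \<le> card (copies H G - isolated_copies G)} \<le> exp (- (K * \<mu> n))"
proof -
  define \<beta> where "\<beta> = 1 / ((1 + real \<Delta>) ^ (v + 1) * real \<Delta>)"
  have \<beta>: "\<beta> > 0" using \<Delta>_pos by (simp add: \<beta>_def)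
  \<comment> \<open>Chosen so that \<open>s ^ 2 \<le> (2 * e) ^ v\<close> with \<open>s\<close> at
    least \<epsilon>\<mu> and \<mu> at least (m/v)^v yields
    \<open>\<kappa> * m n ^ 2 \<le> 2 * e\<close>. The minimum with 1 ensures
    \<open>\<kappa> ^ v \<le> \<kappa>\<close>.\<close>
  define \<kappa> where "\<kappa> = min 1 ((\<epsilon> / real v ^ v) ^ 2)"
  have \<kappa>: "\<kappa> > 0" "\<kappa> \<le> 1" using assms v_pos by (auto simp: \<kappa>_def)
  \<comment> \<open>Makes \<open>\<beta> * \<kappa> * A / 2\<close> equal to
    \<open>K + 6 * h * (\<epsilon> + 1)\<close>; the part beyond \<open>K\<close> pays for the
    number of cluster sizes.\<close>
  define A where "A = 2 * (K + 6 * real h * (\<epsilon> + 1)) / (\<beta> * \<kappa>)"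
  have A: "A > 0" using assms \<beta> \<kappa> by (auto simp: A_def intro!: divide_pos_pos mult_pos_pos add_pos_nonneg)
  let ?C = "(4 * (\<epsilon> + 1) * real h) ^ 2"
  have "(\<lambda>n. ?C * (ln (real n) ^ (2 * v + 1) * real n powr (- \<beta>))) \<longlonglongrightarrow> 0"
    by (intro tendsto_mult_right_zero polylog_over_power_tendsto_0 \<beta>)
  then have small: "\<forall>\<^sub>F n in sequentially. ?C * (ln (real n) ^ (2 * v + 1) * real n powr (- \<beta>)) < 1"
    by (rule order_tendstoD(2)) simp
  have "1 / A > 0" using A by simp
  from m_power_le[OF this] show ?thesis
    using small p_powr m_ge_1 m_le_ln \<mu>_ge_1 \<mu>_ge \<mu>_le \<mu>_le_polylog eventually_gt_at_top[of 1]
  proof eventually_elim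
    case (elim n)
    let ?s = "nat \<lceil>\<epsilon> * \<mu> n\<rceil>" and ?L = "ln (real n)"
    have n: "real n > 0" and L: "?L > 0" using elim by auto
    have "\<epsilon> * \<mu> n > 0" using elim assms by simp
    then have s: "\<epsilon> * \<mu> n \<le> real ?s" "real ?s \<le> \<epsilon> * \<mu> n + 1" by linarith+
    have s2: "real ?s \<le> (\<epsilon> + 1) * \<mu> n" using s(2) elim by (simp add: algebra_simps)
    define q where "q = real n powr (- (2 * \<beta>)) * m n powr (2 / real \<Delta>) * (4 * real ?s * real h) ^ 2"
    have "m n powr (2 / real \<Delta>) \<le> m n powr 1" using elim degree_ge_2 by (intro powr_mono) auto
    then have m1: "m n powr (2 / real \<Delta>) \<le> ?L" using elim by simp
    have "real ?s \<le> (\<epsilon> + 1) * ?L ^ v"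
      by (rule order_trans[OF s2]) (use elim assms in \<open>auto intro!: mult_left_mono\<close>)
    then have "(4 * real ?s * real h) ^ 2 \<le> (4 * ((\<epsilon> + 1) * ?L ^ v) * real h) ^ 2"
      by (intro power_mono mult_right_mono mult_left_mono) auto
    also have "\<dots> = ((4 * (\<epsilon> + 1) * real h) * ?L ^ v) ^ 2" by (simp only: mult_ac)
    also have "\<dots> = ?C * ?L ^ (2 * v)"
      by (subst power_mult_distrib) (simp add: mult.commute flip: power_mult)
    finally have s3: "(4 * real ?s * real h) ^ 2 \<le> ?C * ?L ^ (2 * v)" .
    have "q \<le> real n powr (- (2 * \<beta>)) * ?L * (?C * ?L ^ (2 * v))"
      unfolding q_def by (intro mult_mono m1 s3 order_refl) (use L in auto)
    also have "real n powr (- (2 * \<beta>)) = real n powr (- \<beta>) * real n powr (- \<beta>)"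
      by (simp flip: powr_add)
    also have "real n powr (- \<beta>) * real n powr (- \<beta>) * ?L * (?C * ?L ^ (2 * v)) =
        real n powr (- \<beta>) * (?C * (?L ^ (2 * v + 1) * real n powr (- \<beta>)))"
      by (simp add: mult_ac)
    also have "\<dots> \<le> real n powr (- \<beta>) * 1" using elim by (intro mult_left_mono) auto
    finally have q: "q \<le> real n powr (- \<beta>)" by simp
    have q0: "q \<ge> 0" by (simp add: q_def)
    have "v = 2 + (v - 2)" using card_verts_ge_3 by simp
    then have "m n ^ v = m n ^ 2 * m n ^ (v - 2)" by (metis power_add)
    also have "\<dots> \<le> m n ^ 2 * (1 / A * ?L)" using elim by (intro mult_left_mono) auto
    finally have mA: "A * m n ^ v \<le> m n ^ 2 * ?L" using A by (simp add: field_simps)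
    have summand: "real n ^ u * (real u ^ 2) ^ e * p n ^ e \<le> exp (- ((K + 6 * real h * (\<epsilon> + 1)) * \<mu> n))"
      if ue: "(u, e) \<in> cluster_sizes ?s" for u e
    proof -
      have "(\<kappa> * m n ^ 2) ^ v = \<kappa> ^ v * (m n ^ v) ^ 2"
        by (simp add: power_mult_distrib mult.commute flip: power_mult)
      also have "\<kappa> ^ v \<le> (\<epsilon> / real v ^ v) ^ 2"
      proof -
        have "\<kappa> ^ v \<le> \<kappa> ^ 1" using \<kappa> card_verts_ge_3 by (intro power_decreasing) auto
        then show ?thesis by (simp add: \<kappa>_def)
      qed
      also have "(\<epsilon> / real v ^ v) ^ 2 * (m n ^ v) ^ 2 = (\<epsilon> * (m n / real v) ^ v) ^ 2"
        by (simp add: power_divide power_mult_distrib)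
      also have "\<dots> \<le> (real ?s) ^ 2"
      proof (rule power_mono)
        have "\<epsilon> * (m n / real v) ^ v \<le> \<epsilon> * \<mu> n" using elim assms by (intro mult_left_mono) auto
        then show "\<epsilon> * (m n / real v) ^ v \<le> real ?s" using s by linarith
      qed (use elim assms in auto)
      also have "\<dots> \<le> (2 * real e) ^ v"
      proof -
        have "?s ^ 2 \<le> (2 * e) ^ v" using ue by (simp add: cluster_sizes_def)
        from of_nat_mono[OF this, where 'a = real] show ?thesis by simp
      qed
      finally have "(\<kappa> * m n ^ 2) ^ v \<le> (2 * real e) ^ v" by (simp add: mult_right_mono)
      then have e: "\<kappa> * m n ^ 2 \<le> 2 * real e"
        by (rule power_mono_iff[THEN iffD1, rotated 3]) (use \<kappa> v_pos in auto)
      have "real n ^ u * (real u ^ 2) ^ e * p n ^ e \<le> q ^ e"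
        unfolding q_def by (rule cluster_term_le[OF ue n _ _ _ \<beta>_def]) (use elim in auto)
      also have "\<dots> \<le> (real n powr (- \<beta>)) ^ e" using q q0 by (intro power_mono) auto
      also have "\<dots> = exp (- (\<beta> * ?L * real e))"
        using n by (simp add: powr_def mult_ac flip: exp_of_nat_mult)
      also have "\<dots> \<le> exp (- ((K + 6 * real h * (\<epsilon> + 1)) * \<mu> n))"
      proof -
        have "(K + 6 * real h * (\<epsilon> + 1)) * \<mu> n = \<beta> * \<kappa> / 2 * (A * \<mu> n)"
          using \<beta> \<kappa> by (simp add: A_def field_simps)
        also have "\<dots> \<le> \<beta> * \<kappa> / 2 * (m n ^ 2 * ?L)"
        proof (intro mult_left_mono)
          have "A * \<mu> n \<le> A * m n ^ v" using A elim by (intro mult_left_mono) auto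
          then show "A * \<mu> n \<le> m n ^ 2 * ?L" using mA by linarith
        qed (use \<beta> \<kappa> in auto)
        also have "\<dots> = \<beta> * ?L * (\<kappa> * m n ^ 2) / 2" by (simp add: mult_ac)
        also have "\<dots> \<le> \<beta> * ?L * (2 * real e) / 2"
          using e \<beta> L by (intro divide_right_mono mult_left_mono) auto
        finally show ?thesis by simp
      qed
      finally show ?thesis .
    qed
    have "measure_pmf.prob (gnp n (p n)) {G. ?s \<le> card (copies H G - isolated_copies G)} \<le>
        (\<Sum>(u, e)\<in>cluster_sizes ?s. real n ^ u * (real u ^ 2) ^ e * p n ^ e)"
      by (rule prob_overlapping_copies_ge[OF p_nonneg p_le_1])
    also have "\<dots> \<le> (\<Sum>(u, e)\<in>cluster_sizes ?s. exp (- ((K + 6 * real h * (\<epsilon> + 1)) * \<mu> n)))"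
      by (intro sum_mono) (use summand in auto)
    also have "\<dots> = real (card (cluster_sizes ?s)) * exp (- ((K + 6 * real h * (\<epsilon> + 1)) * \<mu> n))"
      by simp
    also have "\<dots> \<le> exp (6 * real h * ((\<epsilon> + 1) * \<mu> n)) * exp (- ((K + 6 * real h * (\<epsilon> + 1)) * \<mu> n))"
    proof (intro mult_right_mono)
      have "real (card (cluster_sizes ?s)) \<le> real ((4 * ?s * h + 1) * (2 * ?s * h + 1))"
        by (rule of_nat_mono[OF card_cluster_sizes_le])
      also have "\<dots> = (1 + 4 * real ?s * real h) * (1 + 2 * real ?s * real h)" by (simp add: algebra_simps)
      also have "\<dots> \<le> exp (4 * real ?s * real h) * exp (2 * real ?s * real h)"
        by (intro mult_mono exp_ge_add_one_self) auto
      also have "\<dots> = exp (6 * real h * real ?s)" by (simp flip: exp_add add: algebra_simps)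
      also have "\<dots> \<le> exp (6 * real h * ((\<epsilon> + 1) * \<mu> n))" using s2 by (simp add: mult_left_mono)
      finally show "real (card (cluster_sizes ?s)) \<le> exp (6 * real h * ((\<epsilon> + 1) * \<mu> n))" .
    qed simp
    also have "\<dots> = exp (- (K * \<mu> n))" by (simp flip: exp_add add: algebra_simps)
    finally show ?case .
  qed
qed

text \<open>Either at least (1 + \<delta>')\<mu> copies are isolated or at least (\<delta> -
  \<delta>')\<mu> are not.\<close>

lemma upper_tail_le:
  assumes "0 < \<delta>'" "\<delta>' < \<delta>"
  shows "\<forall>\<^sub>F n in sequentially. upper_tail \<delta> n \<le> 2 * exp (- (((1 + \<delta>') * ln (1 + \<delta>') - \<delta>') * \<mu> n))"
proof -
  define \<phi> where "\<phi> = (1 + \<delta>') * ln (1 + \<delta>') - \<delta>'"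
  \<comment> \<open>With \<open>\<bar>\<phi>\<bar> + 1\<close> as rate, the overlapping part is no
    larger than the isolated one.\<close>
  have "\<delta> - \<delta>' > 0" "\<bar>\<phi>\<bar> + 1 > 0" using assms by auto
  from prob_overlapping_copies_negligible[OF this] show ?thesis
    using \<mu>_ge_1
  proof eventually_elim
    case (elim n)
    let ?P = "measure_pmf.prob (gnp n (p n))"
    let ?s = "nat \<lceil>(\<delta> - \<delta>') * \<mu> n\<rceil>"
    let ?I = "{G :: nat graph. (1 + \<delta>') * \<mu> n \<le> real (card (isolated_copies G))}"
    let ?O = "{G :: nat graph. ?s \<le> card (copies H G - isolated_copies G)}"
    have "{G. copy_count H G \<ge> (1 + \<delta>) * \<mu> n} \<subseteq> ?I \<union> ?O"
    proof (rule subsetI, rule ccontr)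
      fix G :: "nat graph"
      assume G: "G \<in> {G. copy_count H G \<ge> (1 + \<delta>) * \<mu> n}" "G \<notin> ?I \<union> ?O"
      have "(1 + \<delta>) * \<mu> n > 0" using elim assms by simp
      \<comment> \<open>The event ranges over all graphs, where the copies could be infinitely many;
        a positive \<open>card\<close> rules this out.\<close>
      then have "real (card (copies H G)) > 0" using G(1) by (simp add: copy_count_def)
      then have fin: "finite (copies H G)" by (simp add: card_gt_0_iff)
      have sub: "isolated_copies G \<subseteq> copies H G" by (auto simp: isolated_copies_def)
      have "card (copies H G) = card (isolated_copies G) + card (copies H G - isolated_copies G)"
        using card_Diff_subset[OF finite_subset[OF sub fin] sub] card_mono[OF fin sub] by simp
      moreover have "real (card (copies H G - isolated_copies G)) < (\<delta> - \<delta>') * \<mu> n"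
        using G(2) by simp
      moreover have "real (card (isolated_copies G)) < (1 + \<delta>') * \<mu> n" using G(2) by simp
      ultimately show False using G(1) by (simp add: copy_count_def algebra_simps)
    qed
    then have "upper_tail \<delta> n \<le> ?P (?I \<union> ?O)"
      unfolding upper_tail_def by (intro measure_pmf.finite_measure_mono) auto
    also have "\<dots> \<le> ?P ?I + ?P ?O" by (rule measure_Un_le) auto
    \<comment> \<open>The choice z = \<delta>' minimises the exponential moment bound at the level
      (1 + \<delta>')\<mu>.\<close>
    also have "?P ?I \<le> exp (\<delta>' * \<mu> n) / (1 + \<delta>') powr ((1 + \<delta>') * \<mu> n)"
      using prob_isolated_copies_ge[OF p_nonneg p_le_1, of \<delta>'] assms unfolding \<mu>_def by simp
    also have "\<dots> = exp (- (\<phi> * \<mu> n))"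
      using assms by (simp add: powr_def \<phi>_def algebra_simps flip: exp_diff)
    also have "?P ?O \<le> exp (- ((\<bar>\<phi>\<bar> + 1) * \<mu> n))" by (rule elim(1))
    also have "\<dots> \<le> exp (- (\<phi> * \<mu> n))" using elim by (auto intro!: mult_right_mono)
    finally show ?case by (simp add: \<phi>_def)
  qed
qed

text \<open>The upper bound on the probability is available only with \<delta>' < \<delta>, the gap
  making room for non-isolated copies; left continuity of the rate function closes it. The factor 2
  costs ln 2 / \<mu>, which vanishes.\<close>

lemma upper_tail_rate:
  assumes "\<delta> > 0"
  shows "(\<lambda>n. - ln (upper_tail \<delta> n) / \<mu> n) \<longlonglongrightarrow> (1 + \<delta>) * ln (1 + \<delta>) - \<delta>"
proof -
  define \<phi> where "\<phi> x = (1 + x) * ln (1 + x) - x" for x :: real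
  obtain U where U: "\<forall>\<^sub>F n in sequentially. upper_tail \<delta> n > 0 \<and> - ln (upper_tail \<delta> n) / \<mu> n \<le> U n"
    and limU: "U \<longlonglongrightarrow> \<phi> \<delta>"
    using upper_tail_ge[OF assms] unfolding \<phi>_def by blast
  have "(\<lambda>n. - ln (upper_tail \<delta> n) / \<mu> n) \<longlonglongrightarrow> \<phi> \<delta>"
  proof (rule order_tendstoI)
    fix a assume "a > \<phi> \<delta>"
    from order_tendstoD(2)[OF limU this] U
    show "\<forall>\<^sub>F n in sequentially. - ln (upper_tail \<delta> n) / \<mu> n < a"
      by eventually_elim linarith
  next
    fix a assume "a < \<phi> \<delta>"
    have "(\<phi> \<longlongrightarrow> \<phi> \<delta>) (at_left \<delta>)"
      unfolding \<phi>_def using assms by (intro tendsto_intros) auto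
    from order_tendstoD(1)[OF this \<open>a < \<phi> \<delta>\<close>]
      eventually_at_left_real[OF assms]
    have "\<forall>\<^sub>F x in at_left \<delta>. a < \<phi> x \<and> 0 < x \<and> x < \<delta>"
      by eventually_elim simp
    then obtain \<delta>' where \<delta>': "a < \<phi> \<delta>'" "0 < \<delta>'" "\<delta>' < \<delta>"
      using eventually_happens'[OF trivial_limit_at_left_real] by blast
    have "(\<lambda>n. \<phi> \<delta>' - ln 2 * inverse (\<mu> n)) \<longlonglongrightarrow> \<phi> \<delta>' - ln 2 * 0"
      by (intro tendsto_intros tendsto_inverse_0_at_top[OF \<mu>_at_top])
    then have "\<forall>\<^sub>F n in sequentially. a < \<phi> \<delta>' - ln 2 * inverse (\<mu> n)"
      by (rule order_tendstoD(1)) (use \<delta>' in simp)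
    then show "\<forall>\<^sub>F n in sequentially. a < - ln (upper_tail \<delta> n) / \<mu> n"
      using upper_tail_le[OF \<delta>'(2,3)] U \<mu>_ge_1
    proof eventually_elim
      case (elim n)
      have "ln (upper_tail \<delta> n) \<le> ln (2 * exp (- (\<phi> \<delta>' * \<mu> n)))"
        using elim by (simp add: \<phi>_def)
      also have "\<dots> = ln 2 - \<phi> \<delta>' * \<mu> n" by (simp add: ln_mult)
      finally have "(\<phi> \<delta>' * \<mu> n - ln 2) / \<mu> n \<le> - ln (upper_tail \<delta> n) / \<mu> n"
        using elim by (intro divide_right_mono) auto
      moreover have "(\<phi> \<delta>' * \<mu> n - ln 2) / \<mu> n = \<phi> \<delta>' - ln 2 * inverse (\<mu> n)"
        using elim by (simp add: field_simps)
      ultimately show ?case using elim by linarith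
    qed
  qed
  then show ?thesis by (simp add: \<phi>_def)
qed

end

theorem theorem1p6:
  fixes \<Delta> :: nat and H :: "'a graph" and \<delta> :: real and p :: "nat \<Rightarrow> real"
  assumes "\<Delta> \<ge> 2"
    and "finite (verts H)" and "simple_graph H"
    and "connected_graph H" and "regular_graph \<Delta> H"
    and "\<delta> > 0"
    and "\<And>n. 0 \<le> p n \<and> p n \<le> 1"
    and "(\<lambda>n. 1 / real n) \<in> o(\<lambda>n. p n powr (real \<Delta> / 2))"
    and "(\<lambda>n. p n powr (real \<Delta> / 2)) \<in>
           o(\<lambda>n. 1 / real n * ln (real n) powr (1 / (real (card (verts H)) - 2)))"
  shows "(\<lambda>n. - ln (measure_pmf.prob (gnp n (p n))
                     {G. copy_count H G \<ge> (1 + \<delta>) * measure_pmf.expectation (gnp n (p n)) (copy_count H)})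
               / measure_pmf.expectation (gnp n (p n)) (copy_count H))
         \<longlonglongrightarrow> (1 + \<delta>) * ln (1 + \<delta>) - \<delta>"
proof -
  interpret poisson_regime H \<Delta> p
    by unfold_locales (use assms in auto)
  have "measure_pmf.expectation (gnp n (p n)) (copy_count H) = \<mu> n" for n
    using expectation_copy_count[OF p_nonneg p_le_1] by (simp add: \<mu>_def)
  then show ?thesis using upper_tail_rate[OF \<open>\<delta> > 0\<close>] by (simp add: upper_tail_def)
qed

end
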